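(* Let $P=[p_0,p_0^q,p_0^m,p_1^r,p_1^q,p_1^m,p_2^r,p_2^q,p_2^m,\ldots]$ be a $\tau^W$-symmetry of the reduced quasi-classical self-dual Yang-Mills equation $u_{yz}=u_{tx}-u_zu_{xx}+u_xu_{xz}$, i.e. a sequence of smooth functions on $\tilde{\mathcal E}^W$ satisfying conditions (NS1)-(NS9) of the context. Let $\hat P=[\hat p_0,\hat p_0^q,\hat p_0^m,\hat p_1^r,\hat p_1^q,\hat p_1^m,\hat p_2^r,\hat p_2^q,\hat p_2^m,\ldots]$ be the vector-valued function such that for all $\alpha\ge 0$, $\beta\ge 1$ $$\hat p_0=u_xp_0+p_1^r,\qquad \hat p_\alpha^q=q_{\alpha,x}p_0+p_{\alpha-1}^q,$$ $$\hat p_\alpha^m=m_{\alpha,x}p_0-\frac1t\,p_{\alpha-1}^m-\frac zt\,p_\alpha^m,\qquad \hat p_\beta^r=r_{\beta,x}p_0-p_{\beta+1}^r,$$ where $p_{-1}^q=p_{-1}^m=0$. Then $\hat P$ is also a $\tau^W$-symmetry of this equation.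
   Context: **The space $\tilde{\mathcal E}^W$.** Its (internal) coordinates are: $x,y,z,t$; $u_{x^it^j}$ ($i,j\ge0$), $u_{x^iy^kt^j}$ and $u_{x^iz^lt^j}$ ($i,j\ge 0$, $k,l\ge1$); $q_\alpha^{a,b}$, $m_\alpha^{a,b}$ ($\alpha,a,b\ge0$); $r_\beta^{a,b}$ ($\beta\ge1$, $a,b\ge0$). Write $u=u_{x^0t^0}$, $q_\alpha=q_\alpha^{0,0}$, $m_\alpha=m_\alpha^{0,0}$, $r_\beta=r_\beta^{0,0}$, and set $r_0=-u$, $q_{-1}^{a,b}=m_{-1}^{a,b}=0$. A function on $\tilde{\mathcal E}^W$ depends on finitely many of these coordinates; the region $t\neq0$ is considered. **Total derivatives.** $\tilde D_x,\tilde D_y,\tilde D_z,\tilde D_t$ are the derivations (vector fields) on functions on $\tilde{\mathcal E}^W$ acting on $x,y,z,t$ as the corresponding partial derivatives and on the other coordinates as follows. Put $G=u_{tx}-u_zu_{xx}+u_xu_{xz}$. - $\tilde D_x$ and $\tilde D_t$ raise $i$, resp. $j$, by one in every $u$-coordinate. - $\tilde D_y u_{x^it^j}=u_{x^iyt^j}$, $\tilde D_yu_{x^iy^kt^j}=u_{x^iy^{k+1}t^j}$, $\tilde D_yu_{x^iz^lt^j}=\tilde D_x^i\tilde D_z^{l-1}\tilde D_t^j(G)$. - $\tilde D_z u_{x^it^j}=u_{x^izt^j}$, $\tilde D_zu_{x^iz^lt^j}=u_{x^iz^{l+1}t^j}$, $\tilde D_zu_{x^iy^kt^j}=\tilde D_x^i\tilde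 D_y^{k-1}\tilde D_t^j(G)$. - $\tilde D_xq_\alpha^{a,b}=q_\alpha^{a+1,b}$, $\tilde D_zq_\alpha^{a,b}=q_\alpha^{a,b+1}$, $\tilde D_yq_\alpha^{a,b}=\tilde D_x^a\tilde D_z^b(u_xq_\alpha^{1,0}+q_{\alpha-1}^{1,0})$, $\tilde D_tq_\alpha^{a,b}=\tilde D_x^a\tilde D_z^b(u_zq_\alpha^{1,0}+q_{\alpha-1}^{0,1})$. - $\tilde D_xm_\alpha^{a,b}=m_\alpha^{a+1,b}$, $\tilde D_zm_\alpha^{a,b}=m_\alpha^{a,b+1}$, $\tilde D_ym_\alpha^{a,b}=\tilde D_x^a\tilde D_z^b\big(u_xm_\alpha^{1,0}-\frac zt m_\alpha^{1,0}-\frac1t m_{\alpha-1}^{1,0}\big)$, $\tilde D_tm_\alpha^{a,b}=\tilde D_x^a\tilde D_z^b\big(u_zm_\alpha^{1,0}-\frac zt m_\alpha^{0,1}-\frac1t m_{\alpha-1}^{0,1}\big)$. - $\tilde D_yr_\beta^{a,b}=r_\beta^{a+1,b}$, $\tilde D_tr_\beta^{a,b}=r_\beta^{a,b+1}$, and inductively on $\beta\ge1$: $\tilde D_xr_\beta^{a,b}=\tilde D_y^a\tilde D_t^b(u_x\tilde D_xr_{\beta-1}-\tilde D_yr_{\beta-1})$, $\tilde D_zr_\beta^{a,b}=\tilde D_y^a\tilde D_t^b(u_z\tilde D_xr_{\beta-1}-\tilde D_tr_{\beta-1})$. These four derivations pairwise commute. Subscripts denote total derivatives: $q_{\alpha,x}=\tilde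 D_xq_\alpha=q_\alpha^{1,0}$, $m_{\alpha,x}=\tilde D_xm_\alpha=m_\alpha^{1,0}$, $r_{\beta,x}=\tilde D_xr_\beta$ (so $r_{0,x}=-u_x$), etc.; $\tilde D_{yz}=\tilde D_y\tilde D_z$, etc. **$\tau^W$-symmetries.** A $\tau^W$-symmetry (identified with its generating function) is a sequence $P=[p_0,p_0^q,p_0^m,p_1^r,p_1^q,p_1^m,p_2^r,p_2^q,p_2^m,\ldots]$ of functions on $\tilde{\mathcal E}^W$ satisfying, for all $\alpha\ge0$, $\beta\ge2$, with $p_{-1}^q=p_{-1}^m=0$: - (NS1) $\tilde D_{yz}(p_0)-\tilde D_{tx}(p_0)+u_z\tilde D_{xx}(p_0)-u_x\tilde D_{xz}(p_0)+u_{xx}\tilde D_z(p_0)-u_{xz}\tilde D_x(p_0)=0$; - (NS2) $\tilde D_t(p_\alpha^q)-u_z\tilde D_x(p_\alpha^q)-q_{\alpha,x}\tilde D_z(p_0)-\tilde D_z(p_{\alpha-1}^q)=0$; - (NS3) $\tilde D_y(p_\alpha^q)-u_x\tilde D_x(p_\alpha^q)-q_{\alpha,x}\tilde D_x(p_0)-\tilde D_x(p_{\alpha-1}^q)=0$; - (NS4) $\tilde D_t(p_\alpha^m)-u_z\tilde D_x(p_\alpha^m)-m_{\alpha,x}\tilde D_z(p_0)+\frac zt\tilde D_z(p_\alpha^m)+\frac1t\tilde D_z(p_{\alpha-1}^m)=0$; - (NS5) $\tilde D_y(p_\alpha^m)-u_x\tilde D_x(p_\alpha^m)-m_{\alpha,x}\tilde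 D_x(p_0)+\frac zt\tilde D_x(p_\alpha^m)+\frac1t\tilde D_x(p_{\alpha-1}^m)=0$; - (NS6) $\tilde D_x(p_1^r)-\tilde D_y(p_0)+2u_x\tilde D_x(p_0)=0$; - (NS7) $\tilde D_z(p_1^r)-\tilde D_t(p_0)+u_x\tilde D_z(p_0)+u_z\tilde D_x(p_0)=0$; - (NS8) $\tilde D_x(p_\beta^r)-u_x\tilde D_x(p_{\beta-1}^r)-r_{\beta-1,x}\tilde D_x(p_0)+\tilde D_y(p_{\beta-1}^r)=0$; - (NS9) $\tilde D_z(p_\beta^r)-u_z\tilde D_x(p_{\beta-1}^r)-r_{\beta-1,x}\tilde D_z(p_0)+\tilde D_t(p_{\beta-1}^r)=0$. *)

theory Defs
  imports "HOL-Analysis.Analysis"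
begin

text \<open>
  Internal coordinates. \<open>U i j\<close> is $u_{x^i t^j}$. The indices which the mathematics starts at 1
  are shifted to start at 0: \<open>UY i k j\<close> is $u_{x^i y^{k+1} t^j}$, \<open>UZ i l j\<close> is
  $u_{x^i z^{l+1} t^j}$ and \<open>R n a b\<close> is $r_{n+1}^{a,b}$. \<open>Q \<alpha> a b\<close> and \<open>M \<alpha> a b\<close> are
  $q_\alpha^{a,b}$ and $m_\alpha^{a,b}$.
\<close>

datatype coord = CX | CY | CZ | CT
  | U nat nat | UY nat nat nat | UZ nat nat nat
  | Q nat nat nat | M nat nat nat | R nat nat nat

type_synonym pt = "coord \<Rightarrow> real"
type_synonym fn = "pt \<Rightarrow> real"

text \<open>
  Functions live on the region $t \neq 0$; their values outside it are irrelevant.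
\<close>

definition region :: "pt set" where
  "region = {p. p CT \<noteq> 0}"

definition pd :: "coord \<Rightarrow> fn \<Rightarrow> fn" where
  "pd c f p = deriv (\<lambda>s. f (p(c := s))) (p c)"

text \<open>
  Continuity refers to the product topology; for a function of finitely many coordinates this is
  ordinary continuity in those coordinates.
\<close>

definition smooth_fn :: "fn \<Rightarrow> bool" where
  "smooth_fn f \<longleftrightarrow>
     (\<exists>S. finite S \<and>
        (\<forall>p\<in>region. \<forall>p'\<in>region. (\<forall>c\<in>S. p c = p' c) \<longrightarrow> f p = f p')) \<and>
     (\<forall>cs. continuous_on region (foldr pd cs f) \<and>
        (\<forall>c. \<forall>p\<in>region. (\<lambda>s. foldr pd cs f (p(c := s))) differentiable (at (p c))))"

text \<open>
  The vector field with components \<open>V c\<close>. For a function of finitely many coordinates only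
  finitely many partial derivatives are nonzero.
\<close>

definition vfield :: "(coord \<Rightarrow> fn) \<Rightarrow> fn \<Rightarrow> fn" where
  "vfield V f p = (\<Sum>c | pd c f p \<noteq> 0. V c p * pd c f p)"

text \<open>
  Shift of a family by one index, with the member of index $-1$ equal to zero.
\<close>

primrec prev :: "(nat \<Rightarrow> fn) \<Rightarrow> nat \<Rightarrow> fn" where
  "prev f 0 = (\<lambda>p. 0)"
| "prev f (Suc \<alpha>) = f \<alpha>"

abbreviation ux :: fn where "ux \<equiv> \<lambda>p. p (U 1 0)"
abbreviation uz :: fn where "uz \<equiv> \<lambda>p. p (UZ 0 0 0)"
abbreviation uxx :: fn where "uxx \<equiv> \<lambda>p. p (U 2 0)"
abbreviation uxz :: fn where "uxz \<equiv> \<lambda>p. p (UZ 1 0 0)"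
abbreviation utx :: fn where "utx \<equiv> \<lambda>p. p (U 1 1)"

abbreviation qx :: "nat \<Rightarrow> fn" where "qx \<alpha> \<equiv> \<lambda>p. p (Q \<alpha> 1 0)"
abbreviation qz :: "nat \<Rightarrow> fn" where "qz \<alpha> \<equiv> \<lambda>p. p (Q \<alpha> 0 1)"
abbreviation mx :: "nat \<Rightarrow> fn" where "mx \<alpha> \<equiv> \<lambda>p. p (M \<alpha> 1 0)"
abbreviation mz :: "nat \<Rightarrow> fn" where "mz \<alpha> \<equiv> \<lambda>p. p (M \<alpha> 0 1)"

primrec r :: "nat \<Rightarrow> fn" where
  "r 0 = (\<lambda>p. - p (U 0 0))"
| "r (Suc n) = (\<lambda>p. p (R n 0 0))"

definition G :: fn where
  "G p = utx p - uz p * uxx p + ux p * uxz p"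

text \<open>
  The components of the total derivatives refer to each other, so they are introduced in layers.
  The fields \<open>Vx0\<close>, \<open>Vt0\<close>, \<open>Vz0\<close> are the total derivatives on those coordinates where these
  simply raise an index, and have the dummy component 0 on the coordinates marked below; they
  are only ever applied to functions independent of the latter. The lemmas at the end
  of the theory state the resulting actions on the coordinates without reference to the layers.
\<close>

fun Vx0 :: "coord \<Rightarrow> fn" where
  "Vx0 CX = (\<lambda>p. 1)"
| "Vx0 CY = (\<lambda>p. 0)"
| "Vx0 CZ = (\<lambda>p. 0)"
| "Vx0 CT = (\<lambda>p. 0)"
| "Vx0 (U i j) = (\<lambda>p. p (U (Suc i) j))"
| "Vx0 (UY i k j) = (\<lambda>p. p (UY (Suc i) k j))"
| "Vx0 (UZ i l j) = (\<lambda>p. p (UZ (Suc i) l j))"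
| "Vx0 (Q \<alpha> a b) = (\<lambda>p. p (Q \<alpha> (Suc a) b))"
| "Vx0 (M \<alpha> a b) = (\<lambda>p. p (M \<alpha> (Suc a) b))"
| "Vx0 (R n a b) = (\<lambda>p. 0)" (* dummy *)

fun Vz0 :: "coord \<Rightarrow> fn" where
  "Vz0 CX = (\<lambda>p. 0)"
| "Vz0 CY = (\<lambda>p. 0)"
| "Vz0 CZ = (\<lambda>p. 1)"
| "Vz0 CT = (\<lambda>p. 0)"
| "Vz0 (U i j) = (\<lambda>p. p (UZ i 0 j))"
| "Vz0 (UY i k j) = (\<lambda>p. 0)" (* dummy *)
| "Vz0 (UZ i l j) = (\<lambda>p. p (UZ i (Suc l) j))"
| "Vz0 (Q \<alpha> a b) = (\<lambda>p. p (Q \<alpha> a (Suc b)))"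
| "Vz0 (M \<alpha> a b) = (\<lambda>p. p (M \<alpha> a (Suc b)))"
| "Vz0 (R n a b) = (\<lambda>p. 0)" (* dummy *)

fun Vt0 :: "coord \<Rightarrow> fn" where
  "Vt0 CX = (\<lambda>p. 0)"
| "Vt0 CY = (\<lambda>p. 0)"
| "Vt0 CZ = (\<lambda>p. 0)"
| "Vt0 CT = (\<lambda>p. 1)"
| "Vt0 (U i j) = (\<lambda>p. p (U i (Suc j)))"
| "Vt0 (UY i k j) = (\<lambda>p. p (UY i k (Suc j)))"
| "Vt0 (UZ i l j) = (\<lambda>p. p (UZ i l (Suc j)))"
| "Vt0 (Q \<alpha> a b) = (\<lambda>p. 0)" (* dummy *)
| "Vt0 (M \<alpha> a b) = (\<lambda>p. 0)" (* dummy *)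
| "Vt0 (R n a b) = (\<lambda>p. p (R n a (Suc b)))"

definition xz0 :: "nat \<Rightarrow> nat \<Rightarrow> fn \<Rightarrow> fn" where
  "xz0 a b f = (vfield Vx0 ^^ a) ((vfield Vz0 ^^ b) f)"

definition qy :: "nat \<Rightarrow> fn" where
  "qy \<alpha> p = ux p * qx \<alpha> p + prev qx \<alpha> p"

definition qt :: "nat \<Rightarrow> fn" where
  "qt \<alpha> p = uz p * qx \<alpha> p + prev qz \<alpha> p"

definition my :: "nat \<Rightarrow> fn" where
  "my \<alpha> p = ux p * mx \<alpha> p - p CZ / p CT * mx \<alpha> p - 1 / p CT * prev mx \<alpha> p"

definition mt :: "nat \<Rightarrow> fn" where
  "mt \<alpha> p = uz p * mx \<alpha> p - p CZ / p CT * mz \<alpha> p - 1 / p CT * prev mz \<alpha> p"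

fun Vy :: "coord \<Rightarrow> fn" where
  "Vy CX = (\<lambda>p. 0)"
| "Vy CY = (\<lambda>p. 1)"
| "Vy CZ = (\<lambda>p. 0)"
| "Vy CT = (\<lambda>p. 0)"
| "Vy (U i j) = (\<lambda>p. p (UY i 0 j))"
| "Vy (UY i k j) = (\<lambda>p. p (UY i (Suc k) j))"
| "Vy (UZ i l j) = xz0 i l ((vfield Vt0 ^^ j) G)"
| "Vy (Q \<alpha> a b) = xz0 a b (qy \<alpha>)"
| "Vy (M \<alpha> a b) = xz0 a b (my \<alpha>)"
| "Vy (R n a b) = (\<lambda>p. p (R n (Suc a) b))"

fun Vt :: "coord \<Rightarrow> fn" where
  "Vt (Q \<alpha> a b) = xz0 a b (qt \<alpha>)"
| "Vt (M \<alpha> a b) = xz0 a b (mt \<alpha>)"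
| "Vt c = Vt0 c"

definition Dy :: "fn \<Rightarrow> fn" where "Dy = vfield Vy"
definition Dt :: "fn \<Rightarrow> fn" where "Dt = vfield Vt"

text \<open>\<open>rx \<beta>\<close> is the total derivative of $r_\beta$ with respect to $x$ (see \<open>Dx_r\<close>).\<close>

primrec rx :: "nat \<Rightarrow> fn" where
  "rx 0 = (\<lambda>p. - ux p)"
| "rx (Suc \<beta>) = (\<lambda>p. ux p * rx \<beta> p - Dy (r \<beta>) p)"

fun Vx :: "coord \<Rightarrow> fn" where
  "Vx (R n a b) = (Dy ^^ a) ((Dt ^^ b) (rx (Suc n)))"
| "Vx c = Vx0 c"

fun Vz :: "coord \<Rightarrow> fn" where
  "Vz (UY i k j) = (vfield Vx0 ^^ i) ((Dy ^^ k) ((Dt ^^ j) G))"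
| "Vz (R n a b) = (Dy ^^ a) ((Dt ^^ b) (\<lambda>p. uz p * rx n p - Dt (r n) p))"
| "Vz c = Vz0 c"

definition Dx :: "fn \<Rightarrow> fn" where "Dx = vfield Vx"
definition Dz :: "fn \<Rightarrow> fn" where "Dz = vfield Vz"

text \<open>
  The entries of the symmetry are \<open>p0\<close>, \<open>pq \<alpha>\<close>, \<open>pm \<alpha>\<close> for \<open>\<alpha> \<ge> 0\<close> and \<open>pr \<beta>\<close> for \<open>\<beta> \<ge> 1\<close>;
  \<open>pr 0\<close> is not constrained.
\<close>

definition tauW_symmetry ::
    "fn \<Rightarrow> (nat \<Rightarrow> fn) \<Rightarrow> (nat \<Rightarrow> fn) \<Rightarrow> (nat \<Rightarrow> fn) \<Rightarrow> bool" where
  "tauW_symmetry p0 pq pm pr \<longleftrightarrow>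
     smooth_fn p0 \<and> (\<forall>\<alpha>. smooth_fn (pq \<alpha>)) \<and> (\<forall>\<alpha>. smooth_fn (pm \<alpha>)) \<and>
     (\<forall>\<beta>\<ge>1. smooth_fn (pr \<beta>)) \<and>
     (\<forall>p\<in>region.
        Dy (Dz p0) p - Dt (Dx p0) p + uz p * Dx (Dx p0) p - ux p * Dx (Dz p0) p
          + uxx p * Dz p0 p - uxz p * Dx p0 p = 0 \<and>
        (\<forall>\<alpha>. Dt (pq \<alpha>) p - uz p * Dx (pq \<alpha>) p - qx \<alpha> p * Dz p0 p
          - Dz (prev pq \<alpha>) p = 0) \<and>
        (\<forall>\<alpha>. Dy (pq \<alpha>) p - ux p * Dx (pq \<alpha>) p - qx \<alpha> p * Dx p0 p
          - Dx (prev pq \<alpha>) p = 0) \<and>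
        (\<forall>\<alpha>. Dt (pm \<alpha>) p - uz p * Dx (pm \<alpha>) p - mx \<alpha> p * Dz p0 p
          + p CZ / p CT * Dz (pm \<alpha>) p + 1 / p CT * Dz (prev pm \<alpha>) p = 0) \<and>
        (\<forall>\<alpha>. Dy (pm \<alpha>) p - ux p * Dx (pm \<alpha>) p - mx \<alpha> p * Dx p0 p
          + p CZ / p CT * Dx (pm \<alpha>) p + 1 / p CT * Dx (prev pm \<alpha>) p = 0) \<and>
        Dx (pr 1) p - Dy p0 p + 2 * ux p * Dx p0 p = 0 \<and>
        Dz (pr 1) p - Dt p0 p + ux p * Dz p0 p + uz p * Dx p0 p = 0 \<and>
        (\<forall>\<beta>\<ge>2. Dx (pr \<beta>) p - ux p * Dx (pr (\<beta> - 1)) p - Dx (r (\<beta> - 1)) p * Dx p0 p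
          + Dy (pr (\<beta> - 1)) p = 0) \<and>
        (\<forall>\<beta>\<ge>2. Dz (pr \<beta>) p - uz p * Dx (pr (\<beta> - 1)) p - Dx (r (\<beta> - 1)) p * Dz p0 p
          + Dt (pr (\<beta> - 1)) p = 0))"

subsection \<open>The total derivatives on coordinates\<close>

definition depends :: "coord set \<Rightarrow> fn \<Rightarrow> bool" where
  "depends A f \<longleftrightarrow> (\<forall>p p'. (\<forall>c\<in>A. p c = p' c) \<longrightarrow> f p = f p')"

lemma depends_pd_0:
  assumes "depends A f" "c \<notin> A"
  shows "pd c f p = 0"
proof -
  have "(\<lambda>s. f (p(c := s))) = (\<lambda>s. f p)"
    using assms unfolding depends_def by (intro ext) (metis fun_upd_other)
  then show ?thesis by (simp add: pd_def)
qed

lemma depends_pd: 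
  assumes "depends A f"
  shows "depends A (pd c f)"
proof (cases "c \<in> A")
  case True
  show ?thesis unfolding depends_def
  proof (intro allI impI)
    fix p p' :: pt assume *: "\<forall>c\<in>A. p c = p' c"
    have "(\<lambda>s. f (p(c := s))) = (\<lambda>s. f (p'(c := s)))"
    proof
      fix s
      have "\<forall>d\<in>A. (p(c := s)) d = (p'(c := s)) d" using * by simp
      then show "f (p(c := s)) = f (p'(c := s))"
        using assms unfolding depends_def by blast
    qed
    then show "pd c f p = pd c f p'" using True * by (simp add: pd_def)
  qed
next
  case False
  then show ?thesis using depends_pd_0[OF assms] by (simp add: depends_def)
qed

lemma depends_vfield:
  assumes f: "depends A f" and V: "\<And>c. c \<in> A \<Longrightarrow> depends A (V c)"
  shows "depends A (vfield V f)"
  unfolding depends_def vfield_def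
proof (intro allI impI)
  fix p p' :: pt assume *: "\<forall>c\<in>A. p c = p' c"
  have pd: "pd c f p = pd c f p'" for c
    using depends_pd[OF f] * unfolding depends_def by blast
  have "V c p = V c p'" if "pd c f p' \<noteq> 0" for c
    using that depends_pd_0[OF f] V * unfolding depends_def by metis
  then show "(\<Sum>c | pd c f p \<noteq> 0. V c p * pd c f p)
      = (\<Sum>c | pd c f p' \<noteq> 0. V c p' * pd c f p')"
    unfolding pd by (intro sum.cong) auto
qed

lemma vfield_cong:
  assumes f: "depends A f" and VW: "\<And>c. c \<in> A \<Longrightarrow> V c = W c"
  shows "vfield V f = vfield W f"
proof
  fix p
  have "V c p = W c p" if "pd c f p \<noteq> 0" for c
    using that depends_pd_0[OF f] VW by metis
  then show "vfield V f p = vfield W f p"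
    unfolding vfield_def by (intro sum.cong) auto
qed

lemma depends_vfield_pow:
  assumes "depends A f" "\<And>c. c \<in> A \<Longrightarrow> depends A (V c)"
  shows "depends A ((vfield V ^^ n) f)"
  by (induction n) (auto intro: depends_vfield assms)

lemma vfield_pow_cong:
  assumes f: "depends A f" and V: "\<And>c. c \<in> A \<Longrightarrow> depends A (V c)"
    and VW: "\<And>c. c \<in> A \<Longrightarrow> V c = W c"
  shows "(vfield V ^^ n) f = (vfield W ^^ n) f"
proof (induction n)
  case (Suc n)
  then show ?case
    using vfield_cong[of A "(vfield V ^^ n) f" V W, OF depends_vfield_pow[OF f V] VW] by simp
qed simp

lemma vfield_coord: "vfield V (\<lambda>p. p c) = V c"
proof
  fix p
  have *: "pd d (\<lambda>p. p c) p = (if d = c then 1 else 0)" for d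
    by (simp add: pd_def)
  have "{d. pd d (\<lambda>p. p c) p \<noteq> 0} = {c}" by (auto simp: *)
  then show "vfield V (\<lambda>p. p c) p = V c p" by (simp add: vfield_def *)
qed

lemma vfield_minus_coord: "vfield V (\<lambda>p. - p c) = (\<lambda>p. - V c p)"
proof
  fix p
  have *: "pd d (\<lambda>p. - p c) p = (if d = c then -1 else 0)" for d
    by (auto simp: pd_def intro!: DERIV_imp_deriv derivative_eq_intros)
  have "{d. pd d (\<lambda>p. - p c) p \<noteq> 0} = {c}" by (auto simp: *)
  then show "vfield V (\<lambda>p. - p c) p = - V c p" by (simp add: vfield_def *)
qed

lemma depends_prev:
  "(\<And>\<alpha>. depends A (f \<alpha>)) \<Longrightarrow> depends A (prev f \<alpha>)"
  by (cases \<alpha>) (auto simp: depends_def)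

definition uzc :: "coord set" where
  "uzc = {c. (\<exists>i j. c = U i j) \<or> (\<exists>i l j. c = UZ i l j)}"
definition uc :: "coord set" where
  "uc = uzc \<union> {c. \<exists>i k j. c = UY i k j}"
definition qc :: "coord set" where
  "qc = uzc \<union> {c. \<exists>\<alpha> a b. c = Q \<alpha> a b}"
definition mc :: "coord set" where
  "mc = uzc \<union> {CZ, CT} \<union> {c. \<exists>\<alpha> a b. c = M \<alpha> a b}"

lemma depends_mono: "depends A f \<Longrightarrow> A \<subseteq> B \<Longrightarrow> depends B f"
  unfolding depends_def by blast

lemma depends_G: "depends uzc G"
  by (simp add: depends_def uzc_def G_def)

lemma depends_qy: "depends qc (qy \<alpha>)" and depends_qt: "depends qc (qt \<alpha>)"
  by (cases \<alpha>; force simp: depends_def uzc_def qc_def qy_def qt_def)+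

lemma depends_my: "depends mc (my \<alpha>)" and depends_mt: "depends mc (mt \<alpha>)"
  by (cases \<alpha>; force simp: depends_def uzc_def mc_def my_def mt_def)+

lemma closed0:
  "c \<in> uzc \<Longrightarrow> depends uzc (Vx0 c)"
  "c \<in> uzc \<Longrightarrow> depends uzc (Vz0 c)"
  "c \<in> uzc \<Longrightarrow> depends uzc (Vt0 c)"
  "c \<in> uc \<Longrightarrow> depends uc (Vx0 c)"
  "c \<in> qc \<Longrightarrow> depends qc (Vx0 c)"
  "c \<in> qc \<Longrightarrow> depends qc (Vz0 c)"
  "c \<in> mc \<Longrightarrow> depends mc (Vx0 c)"
  "c \<in> mc \<Longrightarrow> depends mc (Vz0 c)"
  by (auto simp: depends_def uzc_def uc_def qc_def mc_def)

lemma agree0: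
  "c \<in> uc \<Longrightarrow> Vx0 c = Vx c"
  "c \<in> uzc \<Longrightarrow> Vx0 c = Vx c"
  "c \<in> uzc \<Longrightarrow> Vz0 c = Vz c"
  "c \<in> uzc \<Longrightarrow> Vt0 c = Vt c"
  "c \<in> qc \<Longrightarrow> Vx0 c = Vx c"
  "c \<in> qc \<Longrightarrow> Vz0 c = Vz c"
  "c \<in> mc \<Longrightarrow> Vx0 c = Vx c"
  "c \<in> mc \<Longrightarrow> Vz0 c = Vz c"
  by (auto simp: uzc_def uc_def qc_def mc_def)

lemma xz0_eq:
  assumes f: "depends A f"
    and "\<And>c. c \<in> A \<Longrightarrow> depends A (Vx0 c)" "\<And>c. c \<in> A \<Longrightarrow> depends A (Vz0 c)"
    and "\<And>c. c \<in> A \<Longrightarrow> Vx0 c = Vx c" "\<And>c. c \<in> A \<Longrightarrow> Vz0 c = Vz c"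
  shows "xz0 a b f = (Dx ^^ a) ((Dz ^^ b) f)"
  using vfield_pow_cong[of A f Vz0 Vz b] depends_vfield_pow[of A f Vz0 b] assms
    vfield_pow_cong[of A "(vfield Vz0 ^^ b) f" Vx0 Vx a]
  by (simp add: xz0_def Dx_def Dz_def)

lemma depends_xz0_G: "depends uzc (xz0 i l ((vfield Vt0 ^^ j) G))"
  unfolding xz0_def
  by (intro depends_vfield_pow depends_G closed0)

lemma depends_DyDt_G: "depends uc ((Dy ^^ k) ((Dt ^^ j) G))"
proof -
  have "uzc \<subseteq> uc" by (auto simp: uc_def)
  moreover have "c \<in> uc \<Longrightarrow> depends uc (Vy c)" for c
    using depends_mono[OF depends_xz0_G \<open>uzc \<subseteq> uc\<close>]
    by (auto simp: uc_def uzc_def) (auto simp: depends_def)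
  moreover have "c \<in> uc \<Longrightarrow> depends uc (Vt c)" for c
    by (auto simp: uc_def uzc_def depends_def)
  ultimately show ?thesis unfolding Dy_def Dt_def
    by (intro depends_vfield_pow depends_mono[OF depends_G])
qed

lemma Dx_coords:
  "Dx (\<lambda>p. p CX) = (\<lambda>p. 1)"
  "Dx (\<lambda>p. p CY) = (\<lambda>p. 0)"
  "Dx (\<lambda>p. p CZ) = (\<lambda>p. 0)"
  "Dx (\<lambda>p. p CT) = (\<lambda>p. 0)"
  "Dx (\<lambda>p. p (U i j)) = (\<lambda>p. p (U (Suc i) j))"
  "Dx (\<lambda>p. p (UY i k j)) = (\<lambda>p. p (UY (Suc i) k j))"
  "Dx (\<lambda>p. p (UZ i l j)) = (\<lambda>p. p (UZ (Suc i) l j))"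
  "Dx (\<lambda>p. p (Q \<alpha> a b)) = (\<lambda>p. p (Q \<alpha> (Suc a) b))"
  "Dx (\<lambda>p. p (M \<alpha> a b)) = (\<lambda>p. p (M \<alpha> (Suc a) b))"
  by (simp_all add: Dx_def vfield_coord)

lemma Dx_r: "Dx (r \<beta>) = rx \<beta>"
  by (cases \<beta>) (simp_all add: Dx_def vfield_coord vfield_minus_coord)

lemma Dx_R:
  "Dx (\<lambda>p. p (R n a b)) = (Dy ^^ a) ((Dt ^^ b) (\<lambda>p. ux p * Dx (r n) p - Dy (r n) p))"
  unfolding Dx_r by (simp add: Dx_def vfield_coord)

lemma Dy_coords:
  "Dy (\<lambda>p. p CX) = (\<lambda>p. 0)"
  "Dy (\<lambda>p. p CY) = (\<lambda>p. 1)"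
  "Dy (\<lambda>p. p CZ) = (\<lambda>p. 0)"
  "Dy (\<lambda>p. p CT) = (\<lambda>p. 0)"
  "Dy (\<lambda>p. p (U i j)) = (\<lambda>p. p (UY i 0 j))"
  "Dy (\<lambda>p. p (UY i k j)) = (\<lambda>p. p (UY i (Suc k) j))"
  "Dy (\<lambda>p. p (R n a b)) = (\<lambda>p. p (R n (Suc a) b))"
  by (simp_all add: Dy_def vfield_coord)

lemma Dy_UZ: "Dy (\<lambda>p. p (UZ i l j)) = (Dx ^^ i) ((Dz ^^ l) ((Dt ^^ j) G))"
proof -
  have "Dy (\<lambda>p. p (UZ i l j)) = xz0 i l ((vfield Vt0 ^^ j) G)"
    by (simp add: Dy_def vfield_coord)
  also have "\<dots> = (Dx ^^ i) ((Dz ^^ l) ((vfield Vt0 ^^ j) G))"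
    by (rule xz0_eq[of uzc]) (intro depends_vfield_pow depends_G closed0 agree0; assumption)+
  also have "(vfield Vt0 ^^ j) G = (Dt ^^ j) G"
    unfolding Dt_def by (rule vfield_pow_cong[OF depends_G closed0(3) agree0(4)])
  finally show ?thesis .
qed

lemma Dy_Q:
  "Dy (\<lambda>p. p (Q \<alpha> a b)) = (Dx ^^ a) ((Dz ^^ b) (\<lambda>p. ux p * qx \<alpha> p + prev qx \<alpha> p))"
  using xz0_eq[OF depends_qy closed0(5,6) agree0(5,6)]
  by (simp add: Dy_def vfield_coord qy_def[abs_def])

lemma Dy_M:
  "Dy (\<lambda>p. p (M \<alpha> a b)) = (Dx ^^ a) ((Dz ^^ b)
     (\<lambda>p. ux p * mx \<alpha> p - p CZ / p CT * mx \<alpha> p - 1 / p CT * prev mx \<alpha> p))"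
  using xz0_eq[OF depends_my closed0(7,8) agree0(7,8)]
  by (simp add: Dy_def vfield_coord my_def[abs_def])

lemma Dz_coords:
  "Dz (\<lambda>p. p CX) = (\<lambda>p. 0)"
  "Dz (\<lambda>p. p CY) = (\<lambda>p. 0)"
  "Dz (\<lambda>p. p CZ) = (\<lambda>p. 1)"
  "Dz (\<lambda>p. p CT) = (\<lambda>p. 0)"
  "Dz (\<lambda>p. p (U i j)) = (\<lambda>p. p (UZ i 0 j))"
  "Dz (\<lambda>p. p (UZ i l j)) = (\<lambda>p. p (UZ i (Suc l) j))"
  "Dz (\<lambda>p. p (Q \<alpha> a b)) = (\<lambda>p. p (Q \<alpha> a (Suc b)))"
  "Dz (\<lambda>p. p (M \<alpha> a b)) = (\<lambda>p. p (M \<alpha> a (Suc b)))"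
  by (simp_all add: Dz_def vfield_coord)

lemma Dz_UY: "Dz (\<lambda>p. p (UY i k j)) = (Dx ^^ i) ((Dy ^^ k) ((Dt ^^ j) G))"
proof -
  have "Dz (\<lambda>p. p (UY i k j)) = (vfield Vx0 ^^ i) ((Dy ^^ k) ((Dt ^^ j) G))"
    by (simp add: Dz_def vfield_coord)
  also have "\<dots> = (Dx ^^ i) ((Dy ^^ k) ((Dt ^^ j) G))"
    unfolding Dx_def by (rule vfield_pow_cong[OF depends_DyDt_G closed0(4) agree0(1)])
  finally show ?thesis .
qed

lemma Dz_R:
  "Dz (\<lambda>p. p (R n a b)) = (Dy ^^ a) ((Dt ^^ b) (\<lambda>p. uz p * Dx (r n) p - Dt (r n) p))"
  unfolding Dx_r by (simp add: Dz_def vfield_coord)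

lemma Dt_coords:
  "Dt (\<lambda>p. p CX) = (\<lambda>p. 0)"
  "Dt (\<lambda>p. p CY) = (\<lambda>p. 0)"
  "Dt (\<lambda>p. p CZ) = (\<lambda>p. 0)"
  "Dt (\<lambda>p. p CT) = (\<lambda>p. 1)"
  "Dt (\<lambda>p. p (U i j)) = (\<lambda>p. p (U i (Suc j)))"
  "Dt (\<lambda>p. p (UY i k j)) = (\<lambda>p. p (UY i k (Suc j)))"
  "Dt (\<lambda>p. p (UZ i l j)) = (\<lambda>p. p (UZ i l (Suc j)))"
  "Dt (\<lambda>p. p (R n a b)) = (\<lambda>p. p (R n a (Suc b)))"
  by (simp_all add: Dt_def vfield_coord)

lemma Dt_Q:
  "Dt (\<lambda>p. p (Q \<alpha> a b)) = (Dx ^^ a) ((Dz ^^ b) (\<lambda>p. uz p * qx \<alpha> p + prev qz \<alpha> p))"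
  using xz0_eq[OF depends_qt closed0(5,6) agree0(5,6)]
  by (simp add: Dt_def vfield_coord qt_def[abs_def])

lemma Dt_M:
  "Dt (\<lambda>p. p (M \<alpha> a b)) = (Dx ^^ a) ((Dz ^^ b)
     (\<lambda>p. uz p * mx \<alpha> p - p CZ / p CT * mz \<alpha> p - 1 / p CT * prev mz \<alpha> p))"
  using xz0_eq[OF depends_mt closed0(7,8) agree0(7,8)]
  by (simp add: Dt_def vfield_coord mt_def[abs_def])

end

theory Submission
  imports Defs
begin

text \<open>
  By (NS6) and (NS7) the derivatives of \<open>p\<^sub>1\<^sup>r\<close> can be eliminated, so that
  \<open>D\<^sub>x h\<^sub>0 = u\<^sub>x\<^sub>x p\<^sub>0 - u\<^sub>x D\<^sub>x p\<^sub>0 + D\<^sub>y p\<^sub>0\<close> and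
  \<open>D\<^sub>z h\<^sub>0 = u\<^sub>x\<^sub>z p\<^sub>0 + D\<^sub>t p\<^sub>0 - u\<^sub>z D\<^sub>x p\<^sub>0\<close> for the new first entry \<open>h\<^sub>0\<close>.
  Substituted in (NS1), everything cancels except
  \<open>[D\<^sub>y, D\<^sub>t] p\<^sub>0 - u\<^sub>z [D\<^sub>y, D\<^sub>x] p\<^sub>0 + u\<^sub>x [D\<^sub>t, D\<^sub>x] p\<^sub>0\<close>. The other conditions
  involve first derivatives only; they reduce to the conditions on the given symmetry and, for
  (NS9), to the fact that every \<open>r\<^sub>\<beta>\<close> satisfies
  \<open>u\<^sub>x D\<^sub>x\<^sub>z r - D\<^sub>y\<^sub>z r - u\<^sub>z D\<^sub>x\<^sub>x r + D\<^sub>t\<^sub>x r = 0\<close>, which is inductive in \<open>\<beta>\<close>.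
  The commutators are vector fields, since second partial derivatives are symmetric, so it
  suffices that they vanish on the coordinates.
\<close>

section \<open>Calculus of smooth functions on the region\<close>

text \<open>Two uses of the mean value theorem: in \<open>s\<close> for
  \<open>F s (b + h) - F s b\<close>, then in \<open>t\<close> for \<open>F1\<close> at the
  intermediate point.\<close>

lemma mixed_difference:
  fixes F F1 F12 :: "real \<Rightarrow> real \<Rightarrow> real"
  assumes h: "0 < h" "h < e"
    and F1: "\<And>s t. \<lbrakk>\<bar>s - a\<bar> < e; \<bar>t - b\<bar> < e\<rbrakk> \<Longrightarrow>
      ((\<lambda>s. F s t) has_real_derivative F1 s t) (at s)"
    and F12: "\<And>s t. \<lbrakk>\<bar>s - a\<bar> < e; \<bar>t - b\<bar> < e\<rbrakk> \<Longrightarrow>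
      ((\<lambda>t. F1 s t) has_real_derivative F12 s t) (at t)"
  shows "\<exists>\<xi> \<eta>. \<bar>\<xi> - a\<bar> < h \<and> \<bar>\<eta> - b\<bar> < h \<and>
    F (a + h) (b + h) - F (a + h) b - F a (b + h) + F a b = h\<^sup>2 * F12 \<xi> \<eta>"
proof -
  have "\<exists>z>a. z < a + h \<and> (F (a + h) (b + h) - F (a + h) b) - (F a (b + h) - F a b)
      = (a + h - a) * (F1 z (b + h) - F1 z b)"
    by (rule MVT2[where f = "\<lambda>s. F s (b + h) - F s b"])
      (use h in \<open>auto intro!: DERIV_diff F1\<close>)
  then obtain \<xi> where \<xi>: "a < \<xi>" "\<xi> < a + h"
    "(F (a + h) (b + h) - F (a + h) b) - (F a (b + h) - F a b) = h * (F1 \<xi> (b + h) - F1 \<xi> b)"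
    by auto
  have "\<exists>z>b. z < b + h \<and> F1 \<xi> (b + h) - F1 \<xi> b = (b + h - b) * F12 \<xi> z"
    by (rule MVT2) (use h \<xi> in \<open>auto intro!: F12\<close>)
  then obtain \<eta> where "b < \<eta>" "\<eta> < b + h" "F1 \<xi> (b + h) - F1 \<xi> b = h * F12 \<xi> \<eta>"
    by auto
  with \<xi> show ?thesis
    by (intro exI[of _ \<xi>] exI[of _ \<eta>]) (auto simp: power2_eq_square)
qed

text \<open>The second difference over a small square is symmetric in the two variables, so it is
  \<open>h\<^sup>2\<close> times a value of \<open>F12\<close> and also of \<open>F21\<close> near
  \<open>(a, b)\<close>; continuity then excludes a gap.\<close>

lemma mixed_partials_eq:
  fixes F F1 F2 F12 F21 :: "real \<Rightarrow> real \<Rightarrow> real"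
  assumes e: "e > 0"
    and F1: "\<And>s t. \<lbrakk>\<bar>s - a\<bar> < e; \<bar>t - b\<bar> < e\<rbrakk> \<Longrightarrow>
      ((\<lambda>s. F s t) has_real_derivative F1 s t) (at s)"
    and F12: "\<And>s t. \<lbrakk>\<bar>s - a\<bar> < e; \<bar>t - b\<bar> < e\<rbrakk> \<Longrightarrow>
      ((\<lambda>t. F1 s t) has_real_derivative F12 s t) (at t)"
    and F2: "\<And>s t. \<lbrakk>\<bar>s - a\<bar> < e; \<bar>t - b\<bar> < e\<rbrakk> \<Longrightarrow>
      ((\<lambda>t. F s t) has_real_derivative F2 s t) (at t)"
    and F21: "\<And>s t. \<lbrakk>\<bar>s - a\<bar> < e; \<bar>t - b\<bar> < e\<rbrakk> \<Longrightarrow>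
      ((\<lambda>s. F2 s t) has_real_derivative F21 s t) (at s)"
    and c12: "isCont (\<lambda>x. F12 (fst x) (snd x)) (a, b)"
    and c21: "isCont (\<lambda>x. F21 (fst x) (snd x)) (a, b)"
  shows "F12 a b = F21 a b"
proof (rule ccontr)
  assume ne: "F12 a b \<noteq> F21 a b"
  \<comment> \<open>Half the gap: if both values are closer than this to their limits, they cannot
    coincide.\<close>
  define \<epsilon> where "\<epsilon> = \<bar>F12 a b - F21 a b\<bar> / 2"
  have \<epsilon>: "\<epsilon> > 0" using ne by (simp add: \<epsilon>_def)
  obtain d1 where d1: "d1 > 0"
    "\<And>x. dist x (a, b) < d1 \<Longrightarrow> dist (F12 (fst x) (snd x)) (F12 a b) < \<epsilon>"
    using c12 \<epsilon> unfolding continuous_at_eps_delta by force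
  obtain d2 where d2: "d2 > 0"
    "\<And>x. dist x (a, b) < d2 \<Longrightarrow> dist (F21 (fst x) (snd x)) (F21 a b) < \<epsilon>"
    using c21 \<epsilon> unfolding continuous_at_eps_delta by force
  \<comment> \<open>Points of the square have distance below \<open>2 * h\<close> from
    \<open>(a, b)\<close>, hence the division by 2.\<close>
  define h where "h = min (min d1 d2) e / 2"
  have h: "0 < h" "h < e" "2 * h \<le> d1" "2 * h \<le> d2"
    using e d1(1) d2(1) by (auto simp: h_def)
  have close: "dist (\<xi>, \<eta>) (a, b) < 2 * h" if "\<bar>\<xi> - a\<bar> < h" "\<bar>\<eta> - b\<bar> < h" for \<xi> \<eta>
    using that sqrt_sum_squares_le_sum_abs[of "\<xi> - a" "\<eta> - b"]
    by (simp add: dist_Pair_Pair dist_real_def)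
  obtain \<xi> \<eta> where 1: "\<bar>\<xi> - a\<bar> < h" "\<bar>\<eta> - b\<bar> < h"
    "F (a + h) (b + h) - F (a + h) b - F a (b + h) + F a b = h\<^sup>2 * F12 \<xi> \<eta>"
    using mixed_difference[OF h(1,2) F1 F12] by blast
  \<comment> \<open>The same lemma with the two variables exchanged.\<close>
  obtain \<eta>' \<xi>' where 2: "\<bar>\<eta>' - b\<bar> < h" "\<bar>\<xi>' - a\<bar> < h"
    "F (a + h) (b + h) - F a (b + h) - F (a + h) b + F a b = h\<^sup>2 * F21 \<xi>' \<eta>'"
    using mixed_difference[OF h(1,2), of b a "\<lambda>t s. F s t" "\<lambda>t s. F2 s t" "\<lambda>t s. F21 s t"]
      F2 F21 by blast
  have "h\<^sup>2 * F12 \<xi> \<eta> = h\<^sup>2 * F21 \<xi>' \<eta>'" using 1(3) 2(3) by linarith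
  then have "F12 \<xi> \<eta> = F21 \<xi>' \<eta>'" using h(1) by simp
  moreover have "\<bar>F12 \<xi> \<eta> - F12 a b\<bar> < \<epsilon>"
    using d1(2)[of "(\<xi>, \<eta>)"] close[OF 1(1,2)] h by (simp add: dist_real_def)
  moreover have "\<bar>F21 \<xi>' \<eta>' - F21 a b\<bar> < \<epsilon>"
    using d2(2)[of "(\<xi>', \<eta>')"] close[OF 2(2,1)] h by (simp add: dist_real_def)
  ultimately show False
    using abs_triangle_ineq4[of "F12 \<xi> \<eta> - F21 a b" "F12 \<xi> \<eta> - F12 a b"]
    by (simp add: \<epsilon>_def)
qed

section \<open>Finite dependence and partial derivatives on the region\<close>

text \<open>Unlike \<open>depends\<close>, this compares points of the region only, which is all
  that \<open>smooth_fn\<close> controls.\<close>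

definition dep_on :: "coord set \<Rightarrow> fn \<Rightarrow> bool" where
  "dep_on S f \<longleftrightarrow> (\<forall>p\<in>region. \<forall>p'\<in>region. (\<forall>c\<in>S. p c = p' c) \<longrightarrow> f p = f p')"

lemma dep_on_mono: "dep_on S f \<Longrightarrow> S \<subseteq> T \<Longrightarrow> dep_on T f"
  unfolding dep_on_def by blast

lemma dep_on_combine:
  assumes "dep_on S f" "dep_on T g"
  shows "dep_on (S \<union> T) (\<lambda>p. h (f p) (g p))"
  unfolding dep_on_def
proof (intro ballI impI)
  fix p p' assume "p \<in> region" "p' \<in> region" "\<forall>c\<in>S \<union> T. p c = p' c"
  then have "f p = f p'" "g p = g p'" using assms unfolding dep_on_def by blast+
  then show "h (f p) (g p) = h (f p') (g p')" by simp
qed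

text \<open>Only the coordinate \<open>CT\<close> matters, and being nonzero is an open condition.
  Hence partial derivatives at points of the region see only values on the region.\<close>

lemma eventually_region:
  assumes "p \<in> region"
  shows "\<forall>\<^sub>F s in nhds (p c). p(c := s) \<in> region"
proof (cases "c = CT")
  case True
  have "\<forall>\<^sub>F s in nhds (p CT). s \<in> - {0}"
    by (rule eventually_nhds_in_open) (use assms in \<open>auto simp: region_def\<close>)
  then show ?thesis using True by (auto simp: region_def elim: eventually_mono)
qed (use assms in \<open>simp add: region_def\<close>)

lemma pd_cong:
  assumes "\<And>q. q \<in> region \<Longrightarrow> f q = g q" "p \<in> region"
  shows "pd c f p = pd c g p"
  unfolding pd_def
  by (rule deriv_cong_ev[OF eventually_mono[OF eventually_region[OF assms(2)]]])
    (use assms(1) in auto)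

text \<open>For \<open>c = CT\<close> the coordinate line leaves the region, so \<open>f\<close> is
  known to be constant only near \<open>p\<close>; this suffices for the derivative.\<close>

lemma pd_eq_0:
  assumes "dep_on S f" "p \<in> region" "c \<notin> S"
  shows "pd c f p = 0"
proof -
  have "\<forall>\<^sub>F s in nhds (p c). f (p(c := s)) = f p"
    using eventually_region[OF assms(2)]
  proof (rule eventually_mono)
    fix s assume "p(c := s) \<in> region"
    moreover have "\<forall>d\<in>S. (p(c := s)) d = p d" using assms(3) by auto
    ultimately show "f (p(c := s)) = f p" using assms(1,2) unfolding dep_on_def by blast
  qed
  then have "pd c f p = deriv (\<lambda>s. f p) (p c)"
    unfolding pd_def by (rule deriv_cong_ev) simp
  then show ?thesis by simp
qed

lemma dep_on_pd:
  assumes "dep_on S f"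
  shows "dep_on S (pd c f)"
proof (cases "c \<in> S")
  case True
  show ?thesis unfolding dep_on_def
  proof (intro ballI impI)
    fix p p' assume p: "p \<in> region" "p' \<in> region" and *: "\<forall>c\<in>S. p c = p' c"
    have "\<forall>\<^sub>F s in nhds (p c). f (p(c := s)) = f (p'(c := s))"
    proof -
      have "p c = p' c" using * True by auto
      then have "\<forall>\<^sub>F s in nhds (p c). p(c := s) \<in> region \<and> p'(c := s) \<in> region"
        using eventually_region[OF p(1), of c] eventually_region[OF p(2), of c]
        by (auto intro: eventually_conj)
      then show ?thesis
      proof (rule eventually_mono)
        fix s assume "p(c := s) \<in> region \<and> p'(c := s) \<in> region"
        moreover have "\<forall>d\<in>S. (p(c := s)) d = (p'(c := s)) d" using * by simp
        ultimately show "f (p(c := s)) = f (p'(c := s))"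
          using assms unfolding dep_on_def by blast
      qed
    qed
    then show "pd c f p = pd c f p'"
      unfolding pd_def by (rule deriv_cong_ev) (use * True in auto)
  qed
next
  case False
  then show ?thesis using pd_eq_0[OF assms] by (simp add: dep_on_def)
qed

definition pd_differentiable :: "fn \<Rightarrow> bool" where
  "pd_differentiable f \<longleftrightarrow>
    (\<forall>c. \<forall>p\<in>region. (\<lambda>s. f (p(c := s))) differentiable (at (p c)))"

lemma smooth_fn_iff:
  "smooth_fn f \<longleftrightarrow> (\<exists>S. finite S \<and> dep_on S f) \<and>
    (\<forall>cs. continuous_on region (foldr pd cs f) \<and> pd_differentiable (foldr pd cs f))"
  unfolding smooth_fn_def dep_on_def pd_differentiable_def by blast

lemma smooth_fn_dep: "smooth_fn f \<Longrightarrow> \<exists>S. finite S \<and> dep_on S f"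
  by (simp add: smooth_fn_iff)

lemma smooth_fn_continuous: "smooth_fn f \<Longrightarrow> continuous_on region f"
  unfolding smooth_fn_iff by (metis foldr.simps(1) id_apply)

lemma smooth_fn_differentiable: "smooth_fn f \<Longrightarrow> pd_differentiable f"
  unfolding smooth_fn_iff by (metis foldr.simps(1) id_apply)

text \<open>Iterating over \<open>cs\<close> after \<open>pd c\<close> amounts to iterating over
  \<open>cs @ [c]\<close>.\<close>

lemma smooth_fn_pd: "smooth_fn f \<Longrightarrow> smooth_fn (pd c f)"
  unfolding smooth_fn_iff by (metis dep_on_pd foldr.simps comp_apply foldr_append id_apply)

lemma has_pd:
  assumes "pd_differentiable f" "p \<in> region"
  shows "((\<lambda>s. f (p(c := s))) has_real_derivative pd c f p) (at (p c))"
  using assms unfolding pd_differentiable_def pd_def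
  by (simp add: DERIV_deriv_iff_real_differentiable)

lemma pd_eqI:
  "((\<lambda>s. f (p(c := s))) has_real_derivative D) (at (p c)) \<Longrightarrow> pd c f p = D"
  unfolding pd_def by (rule DERIV_imp_deriv)

lemma pd_differentiableI:
  "(\<And>c p. p \<in> region \<Longrightarrow>
     \<exists>D. ((\<lambda>s. f (p(c := s))) has_real_derivative D) (at (p c))) \<Longrightarrow> pd_differentiable f"
  unfolding pd_differentiable_def by (meson real_differentiable_def)

lemma pd_differentiable_cong:
  assumes "\<And>q. q \<in> region \<Longrightarrow> f q = g q" "pd_differentiable f"
  shows "pd_differentiable g"
proof (rule pd_differentiableI)
  fix c p assume p: "p \<in> region"
  have "((\<lambda>s. g (p(c := s))) has_real_derivative pd c f p) (at (p c))"
    using has_pd[OF assms(2) p, of c]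
    by (rule DERIV_cong_ev[OF refl eventually_mono[OF eventually_region[OF p]] refl, THEN iffD1,
          rotated]) (rule assms(1))
  then show "\<exists>D. ((\<lambda>s. g (p(c := s))) has_real_derivative D) (at (p c))" ..
qed

section \<open>Closure of smooth functions under algebraic operations\<close>

lemma pd_add:
  assumes "pd_differentiable f" "pd_differentiable g" "p \<in> region"
  shows "pd c (\<lambda>p. f p + g p) p = pd c f p + pd c g p"
  by (rule pd_eqI) (intro DERIV_add has_pd assms)

lemma pd_mult:
  assumes "pd_differentiable f" "pd_differentiable g" "p \<in> region"
  shows "pd c (\<lambda>p. f p * g p) p = pd c f p * g p + f p * pd c g p"
  by (rule pd_eqI) (use DERIV_mult[OF has_pd[OF assms(1,3), of c] has_pd[OF assms(2,3), of c]] in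
    \<open>simp add: mult.commute\<close>)

lemma coord_derivative:
  "((\<lambda>s. (p(c := s)) d) has_real_derivative (if d = c then 1 else 0)) (at x)"
  by (cases "d = c") auto

lemma pd_coord: "pd c (\<lambda>p. p d) p = (if d = c then 1 else 0)"
  by (rule pd_eqI) (rule coord_derivative)

text \<open>Writing the derivative as a product of copies of \<open>1 / p CT\<close> and a constant
  makes it visibly a member of \<open>smooth_alg\<close>.\<close>

lemma inverse_t_derivative:
  assumes "p \<in> region"
  shows "((\<lambda>s. 1 / (p(c := s)) CT) has_real_derivative
    (if c = CT then - 1 else 0) * (1 / p CT * (1 / p CT))) (at (p c))"
proof (cases "c = CT")
  case True
  with assms show ?thesis
    by (auto simp: region_def field_simps power2_eq_square intro!: derivative_eq_intros)
qed simp

text \<open>Smoothness of algebraic expressions is shown coinductively: each function in the algebra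
  generated by the basic functions is once differentiable, and its partial derivatives agree on
  the region with functions in the algebra.\<close>

inductive_set smooth_alg :: "fn set" where
  smooth: "smooth_fn f \<Longrightarrow> f \<in> smooth_alg"
| const: "(\<lambda>p. a) \<in> smooth_alg"
| coord: "(\<lambda>p. p c) \<in> smooth_alg"
| inv_t: "(\<lambda>p. 1 / p CT) \<in> smooth_alg"
| add: "f \<in> smooth_alg \<Longrightarrow> g \<in> smooth_alg \<Longrightarrow> (\<lambda>p. f p + g p) \<in> smooth_alg"
| mult: "f \<in> smooth_alg \<Longrightarrow> g \<in> smooth_alg \<Longrightarrow> (\<lambda>p. f p * g p) \<in> smooth_alg"

lemma smooth_alg_dep: "f \<in> smooth_alg \<Longrightarrow> \<exists>S. finite S \<and> dep_on S f"
proof (induction rule: smooth_alg.induct)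
  case (add f g)
  then obtain S T where "finite S" "dep_on S f" "finite T" "dep_on T g" by blast
  then show ?case
    using dep_on_combine[of S f T g "(+)"] by (intro exI[of _ "S \<union> T"]) simp
next
  case (mult f g)
  then obtain S T where "finite S" "dep_on S f" "finite T" "dep_on T g" by blast
  then show ?case
    using dep_on_combine[of S f T g "(\<lambda>x y. x * y)"] by (intro exI[of _ "S \<union> T"]) simp
next
  case (coord c)
  show ?case by (intro exI[of _ "{c}"]) (simp add: dep_on_def)
next
  case inv_t
  show ?case by (intro exI[of _ "{CT}"]) (simp add: dep_on_def)
next
  case (const a)
  show ?case by (intro exI[of _ "{}"]) (simp add: dep_on_def)
qed (rule smooth_fn_dep)

lemma continuous_on_coord: "continuous_on A (\<lambda>p::pt. p c)"
  by (rule continuous_on_product_then_coordinatewise) (rule continuous_on_id)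

lemma smooth_alg_continuous: "f \<in> smooth_alg \<Longrightarrow> continuous_on region f"
proof (induction rule: smooth_alg.induct)
  case inv_t
  show ?case
    by (intro continuous_on_divide continuous_on_const continuous_on_coord)
      (simp add: region_def)
qed (auto intro: smooth_fn_continuous continuous_on_const continuous_on_coord
    continuous_on_add continuous_on_mult)

lemma smooth_alg_differentiable: "f \<in> smooth_alg \<Longrightarrow> pd_differentiable f"
proof (induction rule: smooth_alg.induct)
  case (coord c)
  show ?case by (rule pd_differentiableI) (rule exI, rule coord_derivative)
next
  case inv_t
  show ?case by (rule pd_differentiableI) (rule exI, erule inverse_t_derivative)
next
  case (add f g)
  then show ?case
    by (intro pd_differentiableI exI) (rule DERIV_add; rule has_pd; assumption)
next
  case (mult f g)
  then show ?case
    by (intro pd_differentiableI exI) (rule DERIV_mult; rule has_pd; assumption)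
next
  case (const a)
  show ?case by (rule pd_differentiableI) (rule exI, rule DERIV_const)
qed (rule smooth_fn_differentiable)

lemma smooth_alg_pd: "f \<in> smooth_alg \<Longrightarrow> \<exists>g\<in>smooth_alg. \<forall>p\<in>region. pd c f p = g p"
proof (induction rule: smooth_alg.induct)
  case (smooth f)
  show ?case by (rule bexI[OF _ smooth_alg.smooth[OF smooth_fn_pd[OF smooth, of c]]]) simp
next
  case (const a)
  show ?case by (rule bexI[OF _ smooth_alg.const[of 0]]) (simp add: pd_def)
next
  case (coord d)
  show ?case
    by (rule bexI[OF _ smooth_alg.const[of "if d = c then 1 else 0"]]) (simp add: pd_coord)
next
  case inv_t
  let ?a = "if c = CT then - 1 else 0 :: real"
  have "(\<lambda>p. ?a * (1 / p CT * (1 / p CT))) \<in> smooth_alg"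
    by (intro smooth_alg.intros)
  then show ?case
    by (rule bexI[rotated]) (simp add: pd_eqI[OF inverse_t_derivative])
next
  case (add f g)
  then obtain f' g' where "f' \<in> smooth_alg" "\<forall>p\<in>region. pd c f p = f' p"
    "g' \<in> smooth_alg" "\<forall>p\<in>region. pd c g p = g' p" by blast
  with add.hyps show ?case
    by (intro bexI[of _ "\<lambda>p. f' p + g' p"])
      (auto intro: smooth_alg.intros simp: pd_add smooth_alg_differentiable)
next
  case (mult f g)
  then obtain f' g' where "f' \<in> smooth_alg" "\<forall>p\<in>region. pd c f p = f' p"
    "g' \<in> smooth_alg" "\<forall>p\<in>region. pd c g p = g' p" by blast
  with mult.hyps show ?case
    by (intro bexI[of _ "\<lambda>p. f' p * g p + f p * g' p"])
      (auto intro: smooth_alg.intros simp: pd_mult smooth_alg_differentiable)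
qed

lemma smooth_fn_alg:
  assumes "f \<in> smooth_alg"
  shows "smooth_fn f"
proof -
  \<comment> \<open>Iterated partial derivatives stay in the algebra up to their values off the
    region, which \<open>pd_cong\<close> allows to be ignored.\<close>
  have *: "\<exists>g\<in>smooth_alg. \<forall>p\<in>region. g p = foldr pd cs f p" for cs
  proof (induction cs)
    case Nil
    then show ?case using assms by auto
  next
    case (Cons c cs)
    then obtain g where g: "g \<in> smooth_alg" "\<forall>p\<in>region. g p = foldr pd cs f p" by blast
    obtain g' where g': "g' \<in> smooth_alg" "\<forall>p\<in>region. pd c g p = g' p"
      using smooth_alg_pd[OF g(1)] by blast
    have "pd c (foldr pd cs f) p = g' p" if "p \<in> region" for p
      using pd_cong[of g "foldr pd cs f" p c] g(2) g'(2) that by simp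
    with g'(1) show ?case by auto
  qed
  have "continuous_on region (foldr pd cs f) \<and> pd_differentiable (foldr pd cs f)" for cs
  proof -
    obtain g where "g \<in> smooth_alg" "\<forall>p\<in>region. g p = foldr pd cs f p"
      using * by blast
    then show ?thesis
      using continuous_on_cong[of region region g "foldr pd cs f"]
        pd_differentiable_cong[of g "foldr pd cs f"]
        smooth_alg_continuous[of g] smooth_alg_differentiable[of g] by blast
  qed
  then show ?thesis using smooth_alg_dep[OF assms] by (simp add: smooth_fn_iff)
qed

named_theorems smooth_rules

lemma smooth_fn_const [smooth_rules]: "smooth_fn (\<lambda>p. a)"
  and smooth_fn_coord [smooth_rules]: "smooth_fn (\<lambda>p. p c)"
  and smooth_fn_inv_t [smooth_rules]: "smooth_fn (\<lambda>p. 1 / p CT)"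
  by (rule smooth_fn_alg, rule smooth_alg.const smooth_alg.coord smooth_alg.inv_t)+

lemma smooth_fn_add [smooth_rules]:
    "smooth_fn f \<Longrightarrow> smooth_fn g \<Longrightarrow> smooth_fn (\<lambda>p. f p + g p)"
  and smooth_fn_mult [smooth_rules]:
    "smooth_fn f \<Longrightarrow> smooth_fn g \<Longrightarrow> smooth_fn (\<lambda>p. f p * g p)"
  by (rule smooth_fn_alg, rule smooth_alg.add smooth_alg.mult; erule smooth_alg.smooth)+

lemma smooth_fn_minus [smooth_rules]: "smooth_fn f \<Longrightarrow> smooth_fn (\<lambda>p. - f p)"
  using smooth_fn_mult[OF smooth_fn_const[of "-1"]] by simp

lemma smooth_fn_diff [smooth_rules]:
  "smooth_fn f \<Longrightarrow> smooth_fn g \<Longrightarrow> smooth_fn (\<lambda>p. f p - g p)"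
  using smooth_fn_add[OF _ smooth_fn_minus] by simp

lemma smooth_fn_div_t [smooth_rules]: "smooth_fn f \<Longrightarrow> smooth_fn (\<lambda>p. f p / p CT)"
  using smooth_fn_mult[OF _ smooth_fn_inv_t] by simp

lemma smooth_fn_sum:
  "finite S \<Longrightarrow> (\<And>c. c \<in> S \<Longrightarrow> smooth_fn (f c)) \<Longrightarrow> smooth_fn (\<lambda>p. \<Sum>c\<in>S. f c p)"
  by (induction S rule: finite_induct) (auto intro: smooth_rules)

text \<open>By locality of \<open>pd\<close>, agreement on the region passes to all iterated partial
  derivatives.\<close>

lemma smooth_fn_cong:
  assumes eq: "\<And>q. q \<in> region \<Longrightarrow> f q = g q" and f: "smooth_fn f"
  shows "smooth_fn g"
proof -
  have *: "\<forall>p\<in>region. foldr pd cs f p = foldr pd cs g p" for cs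
    by (induction cs) (auto simp: eq intro: pd_cong)
  have "continuous_on region (foldr pd cs g) \<and> pd_differentiable (foldr pd cs g)" for cs
    using f *[of cs] continuous_on_cong[of region region "foldr pd cs f" "foldr pd cs g"]
      pd_differentiable_cong[of "foldr pd cs f" "foldr pd cs g"]
    unfolding smooth_fn_iff by blast
  moreover have "dep_on S g = dep_on S f" for S using eq by (simp add: dep_on_def)
  ultimately show ?thesis using f by (simp add: smooth_fn_iff)
qed

text \<open>Freezing all coordinates except \<open>c\<close> and \<open>d\<close> reduces this to
  the plane.\<close>

lemma pd_commute:
  assumes f: "smooth_fn f" and p: "p \<in> region"
  shows "pd d (pd c f) p = pd c (pd d f) p"
proof (cases "c = d")
  case False
  define q where "q s t = p(c := s, d := t)" for s t
  \<comment> \<open>A change of t by less than its absolute value keeps it nonzero, even if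
    \<open>c\<close> or \<open>d\<close> is \<open>CT\<close>; this fixes the size of the
    square.\<close>
  have q: "q s t \<in> region" if "\<bar>s - p c\<bar> < \<bar>p CT\<bar>" "\<bar>t - p d\<bar> < \<bar>p CT\<bar>" for s t
    using that p by (auto simp: q_def region_def)
  have q1: "(q s t)(c := s') = q s' t" and q2: "(q s t)(d := t') = q s t'"
    and qc: "q s t c = s" and qd: "q s t d = t" for s t s' t'
    using False by (auto simp: q_def fun_upd_twist)
  have D1: "((\<lambda>s. g (q s t)) has_real_derivative pd c g (q s t)) (at s)"
    and D2: "((\<lambda>t. g (q s t)) has_real_derivative pd d g (q s t)) (at t)"
    if "smooth_fn g" "\<bar>s - p c\<bar> < \<bar>p CT\<bar>" "\<bar>t - p d\<bar> < \<bar>p CT\<bar>" for g s t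
    using has_pd[OF smooth_fn_differentiable[OF that(1)] q[OF that(2,3)], of c]
      has_pd[OF smooth_fn_differentiable[OF that(1)] q[OF that(2,3)], of d]
    by (simp_all only: q1 q2 qc qd)
  \<comment> \<open>Continuity in the product topology pulls back along \<open>q\<close>, each
    component of which is \<open>s\<close>, \<open>t\<close> or constant.\<close>
  have cont: "isCont (\<lambda>x. g (q (fst x) (snd x))) (p c, p d)" if g: "smooth_fn g" for g
  proof -
    let ?B = "{x. \<bar>fst x - p c\<bar> < \<bar>p CT\<bar> \<and> \<bar>snd x - p d\<bar> < \<bar>p CT\<bar>}"
    have "continuous_on ?B (\<lambda>x. q (fst x) (snd x) i)" for i
      by (cases "i = d"; cases "i = c")
        (simp_all add: q_def continuous_on_fst continuous_on_snd continuous_on_id)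
    then have "continuous_on ?B (\<lambda>x. q (fst x) (snd x))"
      by (rule continuous_on_coordinatewise_then_product)
    then have "continuous_on ?B (\<lambda>x. g (q (fst x) (snd x)))"
      by (rule continuous_on_compose2[OF smooth_fn_continuous[OF g]]) (auto intro: q)
    moreover have "open ?B"
      by (intro open_Collect_conj open_Collect_less continuous_intros)
    ultimately show ?thesis
      using p by (simp add: continuous_on_eq_continuous_at region_def)
  qed
  note f' = smooth_fn_pd[OF f]
  have "pd d (pd c f) (q (p c) (p d)) = pd c (pd d f) (q (p c) (p d))"
    by (rule mixed_partials_eq[where e = "\<bar>p CT\<bar>", OF _ D1[OF f] D2[OF f'] D2[OF f] D1[OF f']
          cont[OF f'[THEN smooth_fn_pd]] cont[OF f'[THEN smooth_fn_pd]]])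
      (use p in \<open>auto simp: region_def\<close>)
  then show ?thesis by (simp add: q_def)
qed simp

section \<open>Vector fields as derivations\<close>

text \<open>Replaces the index set in \<open>vfield\<close>, which varies with \<open>f\<close> and
  \<open>p\<close>, by a fixed finite one; the extra terms vanish.\<close>

lemma vfield_eq_sum:
  assumes "dep_on S f" "finite S" "p \<in> region"
  shows "vfield V f p = (\<Sum>c\<in>S. V c p * pd c f p)"
  unfolding vfield_def
  by (rule sum.mono_neutral_cong_left) (use assms pd_eq_0 in auto)

lemma vfield_region_cong:
  assumes "\<And>q. q \<in> region \<Longrightarrow> f q = g q" "p \<in> region"
  shows "vfield V f p = vfield V g p"
  unfolding vfield_def using pd_cong[of f g p, OF assms] by simp

lemma vfield_const: "vfield V (\<lambda>p. a) = (\<lambda>p. 0)"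
  by (simp add: vfield_def pd_def fun_eq_iff)

text \<open>A single index set for both functions lets the rules for sums and products be checked
  termwise.\<close>

lemma smooth_fn_common_dep:
  assumes "smooth_fn f" "smooth_fn g"
  obtains S where "finite S" "dep_on S f" "dep_on S g"
proof -
  obtain S T where "finite S" "dep_on S f" "finite T" "dep_on T g"
    using assms smooth_fn_dep by blast
  then show ?thesis using that[of "S \<union> T"] dep_on_mono by blast
qed

lemma vfield_add:
  assumes f: "smooth_fn f" and g: "smooth_fn g" and p: "p \<in> region"
  shows "vfield V (\<lambda>p. f p + g p) p = vfield V f p + vfield V g p"
proof -
  obtain S where S: "finite S" "dep_on S f" "dep_on S g"
    using smooth_fn_common_dep[OF f g] .
  then have "dep_on S (\<lambda>p. f p + g p)"
    using dep_on_combine[of S f S g "(+)"] by simp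
  with S f g p show ?thesis
    by (simp add: vfield_eq_sum[of S] pd_add smooth_fn_differentiable algebra_simps sum.distrib)
qed

lemma vfield_mult:
  assumes f: "smooth_fn f" and g: "smooth_fn g" and p: "p \<in> region"
  shows "vfield V (\<lambda>p. f p * g p) p = vfield V f p * g p + f p * vfield V g p"
proof -
  obtain S where S: "finite S" "dep_on S f" "dep_on S g"
    using smooth_fn_common_dep[OF f g] .
  then have "dep_on S (\<lambda>p. f p * g p)"
    using dep_on_combine[of S f S g "(\<lambda>x y. x * y)"] by simp
  with S f g p show ?thesis
    by (simp add: vfield_eq_sum[of S] pd_mult smooth_fn_differentiable algebra_simps
        sum.distrib sum_distrib_left)
qed

lemma vfield_minus:
  assumes f: "smooth_fn f" and p: "p \<in> region"
  shows "vfield V (\<lambda>p. - f p) p = - vfield V f p"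
  using vfield_mult[OF smooth_fn_const[of "-1"] assms, of V] by (simp add: vfield_const)

lemma vfield_diff:
  assumes f: "smooth_fn f" and g: "smooth_fn g" and p: "p \<in> region"
  shows "vfield V (\<lambda>p. f p - g p) p = vfield V f p - vfield V g p"
  using vfield_add[OF f smooth_fn_minus[OF g] p] by (simp add: vfield_minus g p)

text \<open>The product rule for \<open>p CT * (f p / p CT)\<close>, which is \<open>f p\<close> on
  the region, is solved for the unknown derivative; \<open>V CT\<close> is the derivative of
  t.\<close>

lemma vfield_div_t:
  assumes f: "smooth_fn f" and p: "p \<in> region"
  shows "vfield V (\<lambda>p. f p / p CT) p = vfield V f p / p CT - f p * V CT p / (p CT)\<^sup>2"
proof -
  have t: "p CT \<noteq> 0" using p by (simp add: region_def)
  have *: "vfield V (\<lambda>p. p CT * (f p / p CT)) p = vfield V f p"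
    by (rule vfield_region_cong) (use p in \<open>auto simp: region_def\<close>)
  have "V CT p * (f p / p CT) + p CT * vfield V (\<lambda>p. f p / p CT) p = vfield V f p"
    using vfield_mult[OF smooth_fn_coord smooth_fn_div_t[OF f] p, of V CT]
    unfolding vfield_coord * by simp
  then show ?thesis using t by (simp add: field_simps power2_eq_square)
qed

lemma vfield_sum:
  "finite S \<Longrightarrow> (\<And>c. c \<in> S \<Longrightarrow> smooth_fn (f c)) \<Longrightarrow> p \<in> region \<Longrightarrow>
    vfield V (\<lambda>p. \<Sum>c\<in>S. f c p) p = (\<Sum>c\<in>S. vfield V (f c) p)"
  by (induction S rule: finite_induct) (simp_all add: vfield_const vfield_add smooth_fn_sum)

lemma smooth_fn_vfield:
  assumes V: "\<And>c. smooth_fn (V c)" and f: "smooth_fn f"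
  shows "smooth_fn (vfield V f)"
proof -
  obtain S where S: "finite S" "dep_on S f" using smooth_fn_dep[OF f] by blast
  have "smooth_fn (\<lambda>p. \<Sum>c\<in>S. V c p * pd c f p)"
    by (rule smooth_fn_sum[OF S(1)]) (rule smooth_fn_mult[OF V smooth_fn_pd[OF f]])
  then show ?thesis
    by (rule smooth_fn_cong[rotated]) (rule vfield_eq_sum[OF S(2,1), symmetric])
qed

lemma smooth_fn_vfield_pow:
  assumes "\<And>c. smooth_fn (V c)" and "smooth_fn f"
  shows "smooth_fn ((vfield V ^^ n) f)"
  by (induction n) (auto intro: smooth_fn_vfield assms)

text \<open>Separates the first order part of the composition from the second order part.\<close>

lemma vfield_vfield:
  assumes W: "\<And>c. smooth_fn (W c)" and f: "smooth_fn f" and p: "p \<in> region"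
    and S: "finite S" "dep_on S f"
  shows "vfield V (vfield W f) p = (\<Sum>c\<in>S. vfield V (W c) p * pd c f p) +
    (\<Sum>c\<in>S. \<Sum>d\<in>S. W c p * V d p * pd d (pd c f) p)"
proof -
  have "vfield V (vfield W f) p = vfield V (\<lambda>p. \<Sum>c\<in>S. W c p * pd c f p) p"
    by (rule vfield_region_cong) (use S p vfield_eq_sum in auto)
  also have "\<dots> = (\<Sum>c\<in>S. vfield V (W c) p * pd c f p + W c p * vfield V (pd c f) p)"
    by (subst vfield_sum) (simp_all add: S W f p smooth_fn_pd smooth_fn_mult vfield_mult)
  also have "\<dots> = (\<Sum>c\<in>S. vfield V (W c) p * pd c f p +
      (\<Sum>d\<in>S. W c p * V d p * pd d (pd c f) p))"
    by (simp add: vfield_eq_sum[OF dep_on_pd[OF S(2)] S(1) p] sum_distrib_left mult.assoc)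
  finally show ?thesis by (simp add: sum.distrib)
qed

text \<open>The second order parts of two composed fields agree by the symmetry of second partial
  derivatives, so that commutation need only be checked on coordinates.\<close>

definition commute_on :: "coord set \<Rightarrow> (coord \<Rightarrow> fn) \<Rightarrow> (coord \<Rightarrow> fn) \<Rightarrow> bool" where
  "commute_on A V W \<longleftrightarrow> (\<forall>c\<in>A. \<forall>p\<in>region. vfield V (W c) p = vfield W (V c) p)"

text \<open>Outside \<open>A\<close> the partial derivatives of \<open>f\<close> vanish. Restricting
  to \<open>A\<close> allows commutation to be used before it is known on all coordinates.\<close>

lemma vfield_commute:
  assumes V: "\<And>c. smooth_fn (V c)" and W: "\<And>c. smooth_fn (W c)"
    and f: "smooth_fn f" "depends A f" and c: "commute_on A V W" and p: "p \<in> region"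
  shows "vfield V (vfield W f) p = vfield W (vfield V f) p"
proof -
  obtain S where S: "finite S" "dep_on S f" using smooth_fn_dep[OF f(1)] by blast
  have "vfield V (W c) p * pd c f p = vfield W (V c) p * pd c f p" for c
    using c depends_pd_0[OF f(2)] p by (cases "c \<in> A") (auto simp: commute_on_def)
  then have "(\<Sum>c\<in>S. vfield V (W c) p * pd c f p) = (\<Sum>c\<in>S. vfield W (V c) p * pd c f p)"
    by (rule sum.cong[OF refl])
  moreover have "(\<Sum>c\<in>S. \<Sum>d\<in>S. W c p * V d p * pd d (pd c f) p) =
      (\<Sum>c\<in>S. \<Sum>d\<in>S. V c p * W d p * pd d (pd c f) p)"
    by (subst sum.swap) (simp add: pd_commute[OF f(1) p] mult.commute)
  ultimately show ?thesis
    unfolding vfield_vfield[OF V f(1) p S] vfield_vfield[OF W f(1) p S] by simp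
qed

lemma vfield_pow_region_cong:
  assumes "\<And>q. q \<in> region \<Longrightarrow> f q = g q" "p \<in> region"
  shows "(vfield V ^^ n) f p = (vfield V ^^ n) g p"
  using assms(2)
  by (induction n arbitrary: p) (auto intro: assms(1) vfield_region_cong)

text \<open>Closure of \<open>A\<close> under \<open>V\<close> keeps every power of \<open>V\<close>
  applied to \<open>f\<close> a function of \<open>A\<close>, so that \<open>W\<close> can pass one
  factor at a time.\<close>

lemma vfield_commute_pow:
  assumes V: "\<And>c. smooth_fn (V c)" and W: "\<And>c. smooth_fn (W c)"
    and f: "smooth_fn f" "depends A f" and c: "commute_on A V W"
    and clo: "\<And>c. c \<in> A \<Longrightarrow> depends A (V c)" and p: "p \<in> region"
  shows "vfield W ((vfield V ^^ n) f) p = (vfield V ^^ n) (vfield W f) p"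
  using p
proof (induction n arbitrary: p)
  case (Suc n)
  have "vfield W (vfield V ((vfield V ^^ n) f)) p = vfield V (vfield W ((vfield V ^^ n) f)) p"
    by (rule vfield_commute[OF V W smooth_fn_vfield_pow[OF V f(1)]
          depends_vfield_pow[OF f(2) clo] c Suc.prems, symmetric])
  also have "\<dots> = vfield V ((vfield V ^^ n) (vfield W f)) p"
    by (rule vfield_region_cong[OF Suc.IH Suc.prems])
  finally show ?case by simp
qed simp

section \<open>Commutation of the total derivatives\<close>

lemma smooth_fn_V0 [smooth_rules]:
  "smooth_fn (Vx0 c)" "smooth_fn (Vz0 c)" "smooth_fn (Vt0 c)"
  by (cases c; simp add: smooth_rules)+

lemma smooth_fn_prev [smooth_rules]: "(\<And>\<alpha>. smooth_fn (f \<alpha>)) \<Longrightarrow> smooth_fn (prev f \<alpha>)"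
  by (cases \<alpha>) (auto intro: smooth_rules)

lemma smooth_fn_xz0: "smooth_fn f \<Longrightarrow> smooth_fn (xz0 a b f)"
  unfolding xz0_def by (intro smooth_fn_vfield_pow smooth_rules)

lemma smooth_fn_G [smooth_rules]: "smooth_fn G"
  unfolding G_def[abs_def] by (intro smooth_rules)

lemma smooth_fn_qy [smooth_rules]: "smooth_fn (qy \<alpha>)"
  and smooth_fn_qt [smooth_rules]: "smooth_fn (qt \<alpha>)"
  and smooth_fn_my [smooth_rules]: "smooth_fn (my \<alpha>)"
  and smooth_fn_mt [smooth_rules]: "smooth_fn (mt \<alpha>)"
  unfolding qy_def[abs_def] qt_def[abs_def] my_def[abs_def] mt_def[abs_def]
  by (intro smooth_rules)+

text \<open>The order follows the layers: \<open>Vy\<close> and \<open>Vt\<close> rest on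
  \<open>Vx0\<close>, \<open>Vz0\<close>, \<open>Vt0\<close>, whereas \<open>Vx\<close> and
  \<open>Vz\<close> also involve \<open>Dy\<close>, \<open>Dt\<close> and \<open>rx\<close>.\<close>

lemma smooth_fn_Vy [smooth_rules]: "smooth_fn (Vy c)"
  and smooth_fn_Vt [smooth_rules]: "smooth_fn (Vt c)"
  by (cases c; simp; intro smooth_fn_xz0 smooth_fn_vfield_pow smooth_rules)+

lemma smooth_fn_Dy [smooth_rules]: "smooth_fn f \<Longrightarrow> smooth_fn (Dy f)"
  and smooth_fn_Dt [smooth_rules]: "smooth_fn f \<Longrightarrow> smooth_fn (Dt f)"
  unfolding Dy_def Dt_def by (intro smooth_fn_vfield smooth_rules; assumption)+

lemma smooth_fn_r [smooth_rules]: "smooth_fn (r \<beta>)"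
  by (cases \<beta>) (simp_all add: smooth_rules)

lemma smooth_fn_rx [smooth_rules]: "smooth_fn (rx \<beta>)"
  by (induction \<beta>) (simp_all add: smooth_rules)

lemma smooth_fn_Vx [smooth_rules]: "smooth_fn (Vx c)"
  and smooth_fn_Vz [smooth_rules]: "smooth_fn (Vz c)"
  by (cases c; simp del: rx.simps add: Dy_def Dt_def;
      intro smooth_fn_vfield_pow smooth_fn_vfield smooth_rules)+

lemma smooth_fn_Dx [smooth_rules]: "smooth_fn f \<Longrightarrow> smooth_fn (Dx f)"
  and smooth_fn_Dz [smooth_rules]: "smooth_fn f \<Longrightarrow> smooth_fn (Dz f)"
  unfolding Dx_def Dz_def by (intro smooth_fn_vfield smooth_rules; assumption)+

text \<open>From here on components are expressed through the full fields; the layered equations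
  leave the simplifier below.\<close>

lemmas Vy_UZ = Dy_UZ[unfolded Dx_def Dy_def Dz_def Dt_def vfield_coord]
lemmas Vz_UY = Dz_UY[unfolded Dx_def Dy_def Dz_def Dt_def vfield_coord]

lemma Vy_Q: "Vy (Q \<alpha> a b) = (vfield Vx ^^ a) ((vfield Vz ^^ b) (qy \<alpha>))"
  and Vy_M: "Vy (M \<alpha> a b) = (vfield Vx ^^ a) ((vfield Vz ^^ b) (my \<alpha>))"
  and Vt_Q: "Vt (Q \<alpha> a b) = (vfield Vx ^^ a) ((vfield Vz ^^ b) (qt \<alpha>))"
  and Vt_M: "Vt (M \<alpha> a b) = (vfield Vx ^^ a) ((vfield Vz ^^ b) (mt \<alpha>))"
  using Dy_Q[of \<alpha> a b] Dy_M[of \<alpha> a b] Dt_Q[of \<alpha> a b] Dt_M[of \<alpha> a b]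
  unfolding Dx_def Dy_def Dz_def Dt_def vfield_coord
    qy_def[abs_def] my_def[abs_def] qt_def[abs_def] mt_def[abs_def] .

lemmas V_layers = Vy_UZ Vz_UY Vy_Q Vy_M Vt_Q Vt_M
declare Vy.simps(7,8,9) [simp del] Vt.simps(1,2) [simp del] Vz.simps(1) [simp del]
  rx.simps [simp del]

section \<open>Commutators of the total derivatives on coordinates\<close>

lemma commute_on_mono: "commute_on B V W \<Longrightarrow> A \<subseteq> B \<Longrightarrow> commute_on A V W"
  unfolding commute_on_def by blast

text \<open>Where one field is not a plain shift, its component has powers of the other field
  outermost, and the other field's shift adds one such power.\<close>

lemma Vx_Vy_commute: "commute_on A Vx Vy"
  unfolding commute_on_def
proof (intro ballI)
  fix c p show "vfield Vx (Vy c) p = vfield Vy (Vx c) p"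
    by (cases c) (simp_all add: vfield_coord vfield_const V_layers Dy_def)
qed

text \<open>Coordinates on which \<open>Vy\<close> and \<open>Vt\<close> both merely raise an index,
  and hence commute trivially.\<close>

definition uyrc :: "coord set" where
  "uyrc = {c. (\<exists>i j. c = U i j) \<or> (\<exists>i k j. c = UY i k j) \<or> (\<exists>n a b. c = R n a b)}"

lemma uyrc_closed:
  "c \<in> uyrc \<Longrightarrow> depends uyrc (Vy c)" "c \<in> uyrc \<Longrightarrow> depends uyrc (Vt c)"
  by (auto simp: uyrc_def depends_def)

lemma Dy_r: "Dy (r 0) = (\<lambda>p. - p (UY 0 0 0))" "Dy (r (Suc n)) = (\<lambda>p. p (R n 1 0))"
  by (simp_all add: Dy_def vfield_coord vfield_minus_coord)

lemma depends_rx: "depends uyrc (rx \<beta>)"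
proof (induction \<beta>)
  case 0
  show ?case by (auto simp: depends_def uyrc_def rx.simps)
next
  case (Suc \<beta>)
  moreover have "depends uyrc (Dy (r \<beta>))"
    by (cases \<beta>; simp only: Dy_r) (auto simp: depends_def uyrc_def)
  moreover have "depends uyrc ux" by (auto simp: depends_def uyrc_def)
  ultimately show ?case unfolding depends_def rx.simps by metis
qed

lemma Vy_Vt_commute_uyrc: "commute_on uyrc Vy Vt"
  by (auto simp: commute_on_def uyrc_def vfield_coord)

text \<open>Only the coordinates \<open>R n a b\<close> are not immediate: there \<open>Vt\<close>
  must pass powers of \<open>Vy\<close>, which is possible because \<open>rx\<close> depends on
  \<open>uyrc\<close> alone.\<close>

lemma Vx_Vt_commute: "commute_on A Vx Vt"
  unfolding commute_on_def
proof (intro ballI)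
  fix c p assume p: "p \<in> region"
  show "vfield Vx (Vt c) p = vfield Vt (Vx c) p"
  proof (cases c)
    case (R n a b)
    have "vfield Vt ((vfield Vy ^^ a) ((vfield Vt ^^ b) (rx (Suc n)))) p
        = (vfield Vy ^^ a) (vfield Vt ((vfield Vt ^^ b) (rx (Suc n)))) p"
      by (intro vfield_commute_pow[where A = uyrc] smooth_fn_vfield_pow depends_vfield_pow
          smooth_rules depends_rx uyrc_closed Vy_Vt_commute_uyrc p)
    then show ?thesis by (simp add: R vfield_coord Dy_def Dt_def)
  qed (simp_all add: vfield_coord vfield_const V_layers)
qed

text \<open>On these coordinates \<open>Vx\<close> and \<open>Vz\<close> are index shifts or
  constants.\<close>

definition xzc :: "coord set" where "xzc = uzc \<union> qc \<union> mc"

definition xz_stable :: "coord set \<Rightarrow> bool" where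
  "xz_stable A \<longleftrightarrow> A \<subseteq> xzc \<and> (\<forall>c\<in>A. depends A (Vx c) \<and> depends A (Vz c))"

lemma xz_stable: "xz_stable uzc" "xz_stable qc" "xz_stable mc"
  using closed0 agree0 by (auto simp: xz_stable_def xzc_def)

lemma Vx_Vz_commute: "commute_on xzc Vx Vz"
  by (auto simp: commute_on_def xzc_def uzc_def qc_def mc_def vfield_coord vfield_const)

text \<open>\<open>W\<close> passes first the powers of \<open>Vx\<close>, then those of
  \<open>Vz\<close>; stability keeps all intermediate functions dependent on \<open>A\<close>
  only.\<close>

lemma vfield_xz_pow:
  assumes A: "xz_stable A"
    and W: "\<And>c. smooth_fn (W c)" "commute_on xzc Vx W" "commute_on xzc Vz W"
    and f: "smooth_fn f" "depends A f" and p: "p \<in> region"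
  shows "vfield W ((vfield Vx ^^ a) ((vfield Vz ^^ b) f)) p
    = (vfield Vx ^^ a) ((vfield Vz ^^ b) (vfield W f)) p"
proof -
  have W': "commute_on A Vx W" "commute_on A Vz W"
    and A': "\<And>c. c \<in> A \<Longrightarrow> depends A (Vx c)" "\<And>c. c \<in> A \<Longrightarrow> depends A (Vz c)"
    using A W(2,3) commute_on_mono by (auto simp: xz_stable_def)
  have "vfield W ((vfield Vx ^^ a) ((vfield Vz ^^ b) f)) p
      = (vfield Vx ^^ a) (vfield W ((vfield Vz ^^ b) f)) p"
    by (intro vfield_commute_pow[where A = A] smooth_fn_vfield_pow depends_vfield_pow smooth_rules
        A' W(1) W' f p)
  also have "\<dots> = (vfield Vx ^^ a) ((vfield Vz ^^ b) (vfield W f)) p"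
    by (intro vfield_pow_region_cong vfield_commute_pow[where A = A] smooth_rules A' W(1) W' f p)
  finally show ?thesis .
qed

lemma Vz_xz_pow:
  assumes "xz_stable A" "smooth_fn f" "depends A f" "p \<in> region"
  shows "vfield Vz ((vfield Vx ^^ a) ((vfield Vz ^^ b) f)) p
    = (vfield Vx ^^ a) (vfield Vz ((vfield Vz ^^ b) f)) p"
proof -
  have "commute_on xzc Vz Vz" by (simp add: commute_on_def)
  from vfield_xz_pow[OF assms(1) smooth_fn_Vz Vx_Vz_commute this assms(2-)]
  show ?thesis by (simp add: funpow_swap1)
qed

lemma depends_Dt_pow_G: "depends uzc ((vfield Vt ^^ j) G)"
  by (rule depends_vfield_pow[OF depends_G]) (use closed0 agree0 in metis)

lemma smooth_fn_Dt_pow_G: "smooth_fn ((vfield Vt ^^ j) G)"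
  by (intro smooth_fn_vfield_pow smooth_rules)

text \<open>The shift by \<open>Vz\<close> adds an inner power of \<open>Vz\<close>, and
  \<open>Vz_xz_pow\<close> brings an outer \<open>Vz\<close> to that place.\<close>

lemma Vz_Vt_commute: "commute_on xzc Vz Vt"
  and Vz_Vy_commute: "commute_on xzc Vz Vy"
  unfolding commute_on_def
  by (auto simp: xzc_def uzc_def qc_def mc_def vfield_coord vfield_const V_layers
      Vz_xz_pow[OF xz_stable(1) smooth_fn_Dt_pow_G depends_Dt_pow_G]
      Vz_xz_pow[OF xz_stable(2) smooth_fn_qy depends_qy]
      Vz_xz_pow[OF xz_stable(2) smooth_fn_qt depends_qt]
      Vz_xz_pow[OF xz_stable(3) smooth_fn_my depends_my]
      Vz_xz_pow[OF xz_stable(3) smooth_fn_mt depends_mt])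

lemmas vfield_rules = vfield_add vfield_diff vfield_mult vfield_minus vfield_div_t
  vfield_coord vfield_const

text \<open>Compatibility of the equations for the y- and t-derivatives of q, which holds because
  \<open>Vy\<close> sends \<open>uz\<close> to \<open>G\<close>. A second derivative reaches index
  \<open>\<alpha> - 2\<close>, hence three cases.\<close>

lemma Vy_qt:
  assumes "p \<in> region"
  shows "vfield Vy (qt \<alpha>) p = vfield Vt (qy \<alpha>) p"
proof -
  consider "\<alpha> = 0" | "\<alpha> = Suc 0" | \<beta> where "\<alpha> = Suc (Suc \<beta>)"
    by (metis not0_implies_Suc)
  then show ?thesis
    unfolding qt_def[abs_def] qy_def[abs_def]
    by cases (simp_all add: vfield_rules smooth_rules assms V_layers qy_def[abs_def]
        qt_def[abs_def] G_def numeral_2_eq_2 algebra_simps)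
qed

text \<open>As for q, with further terms from differentiating z/t and 1/t.\<close>

lemma Vy_mt:
  assumes "p \<in> region"
  shows "vfield Vy (mt \<alpha>) p = vfield Vt (my \<alpha>) p"
proof -
  consider "\<alpha> = 0" | "\<alpha> = Suc 0" | \<beta> where "\<alpha> = Suc (Suc \<beta>)"
    by (metis not0_implies_Suc)
  then show ?thesis
    unfolding mt_def[abs_def] my_def[abs_def]
    by (cases; simp add: vfield_rules smooth_rules assms V_layers my_def[abs_def]
        mt_def[abs_def] G_def numeral_2_eq_2)
      (simp_all add: divide_inverse power2_eq_square algebra_simps)
qed

text \<open>On q and m both sides are the same powers of \<open>Vx\<close> and \<open>Vz\<close>,
  applied to the two sides of the compatibility identities.\<close>

lemma Vy_Vt_commute: "commute_on A Vy Vt"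
  unfolding commute_on_def
proof (intro ballI)
  fix c p assume p: "p \<in> region"
  have cong: "(vfield Vx ^^ a) ((vfield Vz ^^ b) f) p = (vfield Vx ^^ a) ((vfield Vz ^^ b) g) p"
    if "\<And>q. q \<in> region \<Longrightarrow> f q = g q" for a b f g
    using that p by (intro vfield_pow_region_cong)
  note y = vfield_xz_pow[OF _ smooth_fn_Vy Vx_Vy_commute Vz_Vy_commute]
  note t = vfield_xz_pow[OF _ smooth_fn_Vt Vx_Vt_commute Vz_Vt_commute]
  show "vfield Vy (Vt c) p = vfield Vt (Vy c) p"
  proof (cases c)
    case (UZ i l j)
    then show ?thesis
      using t[OF xz_stable(1) smooth_fn_Dt_pow_G depends_Dt_pow_G p]
      by (simp add: vfield_coord V_layers)
  next
    case (Q \<alpha> a b)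
    then show ?thesis
      using cong[OF Vy_qt] y[OF xz_stable(2) smooth_fn_qt depends_qt p]
        t[OF xz_stable(2) smooth_fn_qy depends_qy p]
      by (simp add: V_layers)
  next
    case (M \<alpha> a b)
    then show ?thesis
      using cong[OF Vy_mt] y[OF xz_stable(3) smooth_fn_mt depends_mt p]
        t[OF xz_stable(3) smooth_fn_my depends_my p]
      by (simp add: V_layers)
  qed (simp_all add: vfield_coord vfield_const)
qed

lemma depends_UNIV: "depends UNIV f"
proof -
  have "p = p'" if "\<forall>c\<in>UNIV. p c = p' c" for p p' :: pt
    using that by auto
  then show ?thesis unfolding depends_def by blast
qed

text \<open>After the derivatives of the new first entry are substituted, (NS1) involves just these
  three commutators.\<close>

lemma total_commute:
  assumes f: "smooth_fn f" and p: "p \<in> region"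
  shows "Dx (Dy f) p = Dy (Dx f) p" "Dx (Dt f) p = Dt (Dx f) p" "Dy (Dt f) p = Dt (Dy f) p"
  unfolding Dx_def Dy_def Dt_def
  by (rule vfield_commute[OF _ _ f depends_UNIV _ p],
      rule smooth_rules, rule smooth_rules,
      rule Vx_Vy_commute Vx_Vt_commute Vy_Vt_commute)+

section \<open>The recursion on symmetries\<close>

declare r.simps [simp del]

lemmas derivation_rules = vfield_add vfield_diff vfield_mult vfield_minus vfield_div_t vfield_const

lemmas total_rules =
  derivation_rules[where V = Vx, folded Dx_def] derivation_rules[where V = Vy, folded Dy_def]
  derivation_rules[where V = Vz, folded Dz_def] derivation_rules[where V = Vt, folded Dt_def]
  Dx_coords Dy_coords Dz_coords Dt_coords Dx_R Dy_UZ Dy_Q Dy_M Dz_UY Dz_R Dt_Q Dt_M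

lemmas total_region_cong =
  vfield_region_cong[where V = Vx, folded Dx_def] vfield_region_cong[where V = Vy, folded Dy_def]
  vfield_region_cong[where V = Vz, folded Dz_def] vfield_region_cong[where V = Vt, folded Dt_def]

section \<open>Second order identities for the functions \<open>r\<close>\<close>

lemma Dx_r_simps: "Dx (r 0) = (\<lambda>p. - ux p)"
    "Dx (r (Suc n)) = (\<lambda>p. ux p * Dx (r n) p - Dy (r n) p)"
  and Dz_r_simps: "Dz (r 0) = (\<lambda>p. - uz p)"
    "Dz (r (Suc n)) = (\<lambda>p. uz p * Dx (r n) p - Dt (r n) p)"
  and Dy_r_0: "Dy (r 0) = (\<lambda>p. - p (UY 0 0 0))"
  unfolding r.simps
  by (simp_all add: Dx_R Dz_R) (simp_all add: Dx_def Dy_def Dz_def vfield_minus_coord)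

lemma Dz_Dy_r: "p \<in> region \<Longrightarrow> Dz (Dy (r \<beta>)) p = Dy (Dz (r \<beta>)) p"
proof (cases \<beta>)
  case (Suc n)
  then show ?thesis by (simp add: r.simps Dy_coords Dz_R)
qed (simp add: Dy_r_0 Dz_r_simps total_rules smooth_rules)

text \<open>The commutator of \<open>Dz\<close> and \<open>Dx\<close> on
  \<open>r (Suc \<beta>)\<close> is the second expression for \<open>r \<beta>\<close>, so the two
  claims are proved together. With \<open>Dz\<close> and \<open>Dx\<close> exchanged, the second
  claim for \<open>r (Suc \<beta>)\<close> reduces to the other commutators and the value
  \<open>G\<close> of \<open>Dy uz\<close>.\<close>

lemma linearized_r:
  assumes "p \<in> region"
  shows "Dz (Dx (r \<beta>)) p = Dx (Dz (r \<beta>)) p \<and>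
    ux p * Dz (Dx (r \<beta>)) p - Dy (Dz (r \<beta>)) p - uz p * Dx (Dx (r \<beta>)) p + Dt (Dx (r \<beta>)) p = 0"
  using assms
proof (induction \<beta>)
  case 0
  then show ?case
    by (simp add: Dx_r_simps Dz_r_simps total_rules smooth_rules G_def numeral_2_eq_2)
next
  case (Suc \<beta>)
  note p = Suc.prems
  note expand = Dx_r_simps(2) Dz_r_simps(2) total_rules smooth_rules p total_commute
  have *: "Dz (Dx (r (Suc \<beta>))) p = Dx (Dz (r (Suc \<beta>))) p"
    using Suc.IH[OF p, THEN conjunct2] by (simp add: expand Dz_Dy_r algebra_simps)
  show ?case
    by (intro conjI *, unfold *)
      (simp add: expand G_def numeral_2_eq_2 algebra_simps)
qed

theorem proposition1:
  fixes p0 :: fn and pq pm pr :: "nat \<Rightarrow> fn"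
  assumes "tauW_symmetry p0 pq pm pr"
  shows "tauW_symmetry
    (\<lambda>p. ux p * p0 p + pr 1 p)
    (\<lambda>\<alpha> p. qx \<alpha> p * p0 p + prev pq \<alpha> p)
    (\<lambda>\<alpha> p. mx \<alpha> p * p0 p - 1 / p CT * prev pm \<alpha> p - p CZ / p CT * pm \<alpha> p)
    (\<lambda>\<beta> p. Dx (r \<beta>) p * p0 p - pr (\<beta> + 1) p)"
proof -
  define h0 where "h0 = (\<lambda>p. ux p * p0 p + pr 1 p)"
  define hq where "hq = (\<lambda>\<alpha> p. qx \<alpha> p * p0 p + prev pq \<alpha> p)"
  define hm where
    "hm = (\<lambda>\<alpha> p. mx \<alpha> p * p0 p - 1 / p CT * prev pm \<alpha> p - p CZ / p CT * pm \<alpha> p)"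
  define hr where "hr = (\<lambda>\<beta> p. Dx (r \<beta>) p * p0 p - pr (\<beta> + 1) p)"
  note h_defs = h0_def hq_def hm_def hr_def
  \<comment> \<open>\<open>pr\<close> enters with a successor index since nothing is assumed of
    \<open>pr 0\<close>.\<close>
  have smooth: "smooth_fn p0" "\<And>\<alpha>. smooth_fn (pq \<alpha>)" "\<And>\<alpha>. smooth_fn (pm \<alpha>)"
    "\<And>\<beta>. smooth_fn (pr (Suc \<beta>))"
    using assms unfolding tauW_symmetry_def by auto
  note rules = total_rules smooth_rules smooth
  \<comment> \<open>The conditions oriented as rewrite rules: they eliminate \<open>Dt\<close> and
    \<open>Dy\<close> of \<open>pq\<close> and \<open>pm\<close>, and \<open>Dx\<close> and
    \<open>Dz\<close> of \<open>pr\<close>.\<close>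
  have NS: "Dt (pq \<alpha>) p = uz p * Dx (pq \<alpha>) p + qx \<alpha> p * Dz p0 p + Dz (prev pq \<alpha>) p"
    "Dy (pq \<alpha>) p = ux p * Dx (pq \<alpha>) p + qx \<alpha> p * Dx p0 p + Dx (prev pq \<alpha>) p"
    "Dt (pm \<alpha>) p = uz p * Dx (pm \<alpha>) p + mx \<alpha> p * Dz p0 p
       - p CZ / p CT * Dz (pm \<alpha>) p - 1 / p CT * Dz (prev pm \<alpha>) p"
    "Dy (pm \<alpha>) p = ux p * Dx (pm \<alpha>) p + mx \<alpha> p * Dx p0 p
       - p CZ / p CT * Dx (pm \<alpha>) p - 1 / p CT * Dx (prev pm \<alpha>) p"
    "Dx (pr (Suc 0)) p = Dy p0 p - 2 * ux p * Dx p0 p"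
    "Dz (pr (Suc 0)) p = Dt p0 p - ux p * Dz p0 p - uz p * Dx p0 p"
    "Dx (pr (Suc (Suc \<beta>))) p = ux p * Dx (pr (Suc \<beta>)) p + Dx (r (Suc \<beta>)) p * Dx p0 p
       - Dy (pr (Suc \<beta>)) p"
    "Dz (pr (Suc (Suc \<beta>))) p = uz p * Dx (pr (Suc \<beta>)) p + Dx (r (Suc \<beta>)) p * Dz p0 p
       - Dt (pr (Suc \<beta>)) p"
    if "p \<in> region" for p \<alpha> \<beta>
  proof -
    have NS89: "Dx (pr \<beta>) p - ux p * Dx (pr (\<beta> - 1)) p - Dx (r (\<beta> - 1)) p * Dx p0 p
          + Dy (pr (\<beta> - 1)) p = 0"
        "Dz (pr \<beta>) p - uz p * Dx (pr (\<beta> - 1)) p - Dx (r (\<beta> - 1)) p * Dz p0 p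
          + Dt (pr (\<beta> - 1)) p = 0" if "\<beta> \<ge> 2" for \<beta>
      using assms \<open>p \<in> region\<close> that unfolding tauW_symmetry_def by blast+
    show "Dt (pq \<alpha>) p = uz p * Dx (pq \<alpha>) p + qx \<alpha> p * Dz p0 p + Dz (prev pq \<alpha>) p"
      "Dy (pq \<alpha>) p = ux p * Dx (pq \<alpha>) p + qx \<alpha> p * Dx p0 p + Dx (prev pq \<alpha>) p"
      "Dt (pm \<alpha>) p = uz p * Dx (pm \<alpha>) p + mx \<alpha> p * Dz p0 p
         - p CZ / p CT * Dz (pm \<alpha>) p - 1 / p CT * Dz (prev pm \<alpha>) p"
      "Dy (pm \<alpha>) p = ux p * Dx (pm \<alpha>) p + mx \<alpha> p * Dx p0 p
         - p CZ / p CT * Dx (pm \<alpha>) p - 1 / p CT * Dx (prev pm \<alpha>) p"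
      "Dx (pr (Suc 0)) p = Dy p0 p - 2 * ux p * Dx p0 p"
      "Dz (pr (Suc 0)) p = Dt p0 p - ux p * Dz p0 p - uz p * Dx p0 p"
      using assms that unfolding tauW_symmetry_def by (simp_all add: algebra_simps)
    show "Dx (pr (Suc (Suc \<beta>))) p = ux p * Dx (pr (Suc \<beta>)) p
         + Dx (r (Suc \<beta>)) p * Dx p0 p - Dy (pr (Suc \<beta>)) p"
      "Dz (pr (Suc (Suc \<beta>))) p = uz p * Dx (pr (Suc \<beta>)) p
         + Dx (r (Suc \<beta>)) p * Dz p0 p - Dt (pr (Suc \<beta>)) p"
      using NS89[of "Suc (Suc \<beta>)"] by (simp_all add: algebra_simps)
  qed
  have h0: "Dx h0 p = uxx p * p0 p - ux p * Dx p0 p + Dy p0 p"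
    "Dz h0 p = uxz p * p0 p + Dt p0 p - uz p * Dx p0 p" if "p \<in> region" for p
    using that by (simp_all add: h0_def rules NS numeral_2_eq_2 algebra_simps)
  have smooth_h: "smooth_fn h0" "smooth_fn (hq \<alpha>)" "smooth_fn (hm \<alpha>)"
    "smooth_fn (hr \<beta>)" for \<alpha> \<beta>
    by (simp_all add: h_defs smooth_rules smooth)
  have h_NS1: "Dy (Dz h0) p - Dt (Dx h0) p + uz p * Dx (Dx h0) p - ux p * Dx (Dz h0) p
        + uxx p * Dz h0 p - uxz p * Dx h0 p = 0"
    if p: "p \<in> region" for p
  proof -
    let ?x = "\<lambda>p. uxx p * p0 p - ux p * Dx p0 p + Dy p0 p"
    let ?z = "\<lambda>p. uxz p * p0 p + Dt p0 p - uz p * Dx p0 p"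
    \<comment> \<open>The formulas \<open>h0\<close> hold on the region only; that is enough under a
      total derivative.\<close>
    have eqs: "Dx (Dx h0) p = Dx ?x p" "Dt (Dx h0) p = Dt ?x p"
      "Dx (Dz h0) p = Dx ?z p" "Dy (Dz h0) p = Dy ?z p"
      by (rule total_region_cong; simp add: h0 p)+
    show ?thesis
      unfolding eqs h0[OF p]
      by (simp add: p rules total_commute G_def[abs_def] numeral_2_eq_2 algebra_simps)
  qed
  have h_NS2: "Dt (hq \<alpha>) p - uz p * Dx (hq \<alpha>) p - qx \<alpha> p * Dz h0 p
      - Dz (prev hq \<alpha>) p = 0"
    if p: "p \<in> region" for p \<alpha>
    \<comment> \<open>For \<open>\<alpha> = 0\<close> the shifted entries vanish; otherwise the
      given condition at \<open>\<alpha> - 1\<close> applies.\<close>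
    by (cases \<alpha>) (simp_all add: hq_def h0 rules p NS algebra_simps)
  have h_NS3: "Dy (hq \<alpha>) p - ux p * Dx (hq \<alpha>) p - qx \<alpha> p * Dx h0 p
      - Dx (prev hq \<alpha>) p = 0"
    if p: "p \<in> region" for p \<alpha>
    by (cases \<alpha>) (simp_all add: hq_def h0 rules p NS numeral_2_eq_2 algebra_simps)
  have h_NS4: "Dt (hm \<alpha>) p - uz p * Dx (hm \<alpha>) p - mx \<alpha> p * Dz h0 p
        + p CZ / p CT * Dz (hm \<alpha>) p + 1 / p CT * Dz (prev hm \<alpha>) p = 0"
    if p: "p \<in> region" for p \<alpha>
    by (cases \<alpha>; simp add: hm_def h0 rules p NS)
      \<comment> \<open>With the derivatives computed, the inverse of t is treated as one more
        variable.\<close>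
      (simp_all add: divide_inverse power2_eq_square algebra_simps)
  have h_NS5: "Dy (hm \<alpha>) p - ux p * Dx (hm \<alpha>) p - mx \<alpha> p * Dx h0 p
        + p CZ / p CT * Dx (hm \<alpha>) p + 1 / p CT * Dx (prev hm \<alpha>) p = 0"
    if p: "p \<in> region" for p \<alpha>
    by (cases \<alpha>; simp add: hm_def h0 rules p NS numeral_2_eq_2)
      (simp_all add: divide_inverse power2_eq_square algebra_simps)
  \<comment> \<open>\<open>hr 1\<close> contains \<open>pr 2\<close>; (NS8) at index 2 turns its
    x-derivative into \<open>Dy (pr 1)\<close>, which cancels against \<open>Dy h0\<close>.\<close>
  have h_NS6: "Dx (hr 1) p - Dy h0 p + 2 * ux p * Dx h0 p = 0"
    if p: "p \<in> region" for p
    by (simp add: hr_def h0)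
      (simp add: h0_def rules p NS Dx_r_simps Dy_r_0 numeral_2_eq_2 algebra_simps)
  have h_NS7: "Dz (hr 1) p - Dt h0 p + ux p * Dz h0 p + uz p * Dx h0 p = 0"
    if p: "p \<in> region" for p
    by (simp add: hr_def h0)
      (simp add: h0_def rules p NS Dx_r_simps Dy_r_0 G_def numeral_2_eq_2 algebra_simps)
  have h_NS8: "Dx (hr \<beta>) p - ux p * Dx (hr (\<beta> - 1)) p - Dx (r (\<beta> - 1)) p * Dx h0 p
        + Dy (hr (\<beta> - 1)) p = 0"
    if p: "p \<in> region" and \<beta>: "\<beta> \<ge> 2" for p \<beta>
  proof -
    obtain n where n: "\<beta> = 2 + n" using le_Suc_ex[OF \<beta>] ..
    show ?thesis
      \<comment> \<open>Only \<open>Dx (r (Suc (Suc n)))\<close> is expanded; the coefficient of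
        \<open>p0\<close> is then the commutator of \<open>Dx\<close> and \<open>Dy\<close> on
        \<open>r (Suc n)\<close>.\<close>
      by (simp add: n p hr_def h0 rules NS total_commute numeral_2_eq_2 algebra_simps
          Dx_r_simps(2)[of "Suc n"])
  qed
  have h_NS9: "Dz (hr \<beta>) p - uz p * Dx (hr (\<beta> - 1)) p - Dx (r (\<beta> - 1)) p * Dz h0 p
        + Dt (hr (\<beta> - 1)) p = 0"
    if p: "p \<in> region" and \<beta>: "\<beta> \<ge> 2" for p \<beta>
  proof -
    obtain n where n: "\<beta> = 2 + n" using le_Suc_ex[OF \<beta>] ..
    \<comment> \<open>This is the coefficient of \<open>p0\<close> left in (NS9), solved for its
      t-derivative.\<close>
    have lin: "Dt (Dx (r (Suc n))) p = Dy (Dz (r (Suc n))) p + uz p * Dx (Dx (r (Suc n))) p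
        - ux p * Dz (Dx (r (Suc n))) p"
      using linearized_r[OF p, of "Suc n"] by linarith
    show ?thesis
      by (simp add: n p lin hr_def h0 rules NS Dz_Dy_r algebra_simps
          Dx_r_simps(2)[of "Suc n"])
  qed
  have "tauW_symmetry h0 hq hm hr"
    unfolding tauW_symmetry_def
    by (intro conjI ballI allI impI smooth_h
        h_NS1 h_NS2 h_NS3 h_NS4 h_NS5 h_NS6 h_NS7 h_NS8 h_NS9)
  then show ?thesis unfolding h_defs .
qed

end
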